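(* There exists an increasing continuous function $\omega$ on $[0,\infty)$ with $\omega(0)=0$ such that for every homeomorphism $h$ of the circle $T$ onto itself the condition $$|\widehat{f\circ h}(k)|=o(1/|k|)\ \ (|k|\to\infty)\qquad \text{for all } f\in H^\omega(T)$$ fails to be satisfied; that is, for every such $h$ there is an $f\in H^\omega(T)$ for which $|\widehat{f\circ h}(k)|$ is not $o(1/|k|)$ as $|k|\to\infty$.
   Context: $T=\mathbb{R}/2\pi\mathbb{Z}$ is the circle. The Fourier coefficients of an integrable function $x$ on $T$ are $\widehat{x}(k)=\frac{1}{2\pi}\int_T x(t)e^{-ikt}\,dt$, $k\in\mathbb{Z}$. For an increasing continuous function $\omega$ on $[0,\infty)$ with $\omega(0)=0$, $H^\omega(T)$ denotes the class of real-valued functions $f$ on $T$ with $\omega(\delta,f)=O(\omega(\delta))$ as $\delta\to 0^+$, where $\omega(\delta,f)=\sup_{|t_1-t_2|<\delta}|f(t_1)-f(t_2)|$ is the uniform modulus of continuity of $f$. *)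

theory Defs
  imports "HOL-Analysis.Analysis" "HOL-Library.Landau_Symbols"
begin

definition circle_rel :: "real \<Rightarrow> real \<Rightarrow> bool" where
  "circle_rel s t \<longleftrightarrow> (\<exists>k::int. s - t = 2 * pi * of_int k)"

lemma equivp_circle_rel: "equivp circle_rel"
proof (rule equivpI)
  show "reflp circle_rel"
    by (rule reflpI) (auto simp: circle_rel_def intro!: exI[of _ 0])
  show "symp circle_rel"
  proof (rule sympI)
    fix s t assume "circle_rel s t"
    then obtain k :: int where "s - t = 2 * pi * of_int k"
      by (auto simp: circle_rel_def)
    then have "t - s = 2 * pi * of_int (- k)" by simp
    then show "circle_rel t s" unfolding circle_rel_def by blast
  qed
  show "transp circle_rel"
  proof (rule transpI)
    fix s t u assume "circle_rel s t" "circle_rel t u"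
    then obtain k l :: int
      where "s - t = 2 * pi * of_int k" "t - u = 2 * pi * of_int l"
      by (auto simp: circle_rel_def)
    then have "s - u = 2 * pi * of_int (k + l)" by (simp add: algebra_simps)
    then show "circle_rel s u" unfolding circle_rel_def by blast
  qed
qed

text \<open>The canonical projection of the reals onto the circle is \<open>abs_circle\<close>.\<close>

quotient_type circle = real / circle_rel
  by (rule equivp_circle_rel)

instantiation circle :: topological_space
begin

text \<open>The quotient topology.\<close>

definition open_circle :: "circle set \<Rightarrow> bool" where
  "open_circle U \<longleftrightarrow> open (abs_circle -` U)"

instance
proof
  show "open (UNIV :: circle set)"
    by (simp add: open_circle_def)
  show "open (S \<inter> T)" if "open S" "open T" for S T :: "circle set"
    using that by (simp add: open_circle_def vimage_Int open_Int)
  show "open (\<Union>K)" if "\<forall>S\<in>K. open S" for K :: "circle set set"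
    using that by (auto simp: open_circle_def vimage_Union)
qed

end

definition fourier_coeff :: "(circle \<Rightarrow> complex) \<Rightarrow> int \<Rightarrow> complex" where
  "fourier_coeff x k =
     1 / (2 * pi) * (LBINT t:{0..2*pi}. x (abs_circle t) * exp (- \<i> * of_int k * of_real t))"

text \<open>
  Two points of the circle are closer than \<open>\<delta>\<close> iff they have real representatives closer
  than \<open>\<delta>\<close>, so the supremum may be taken over pairs of reals. It is extended real
  valued, since it is infinite for unbounded \<open>f\<close>.
\<close>

definition modulus_of_continuity :: "real \<Rightarrow> (circle \<Rightarrow> real) \<Rightarrow> ereal" where
  "modulus_of_continuity \<delta> f =
     (SUP (s, t) \<in> {(s, t). \<bar>s - t\<bar> < \<delta>}. ereal \<bar>f (abs_circle s) - f (abs_circle t)\<bar>)"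

definition H_class :: "(real \<Rightarrow> real) \<Rightarrow> (circle \<Rightarrow> real) set" where
  "H_class \<omega> =
     {f. \<exists>C::real. \<forall>\<^sub>F \<delta> in at_right 0. modulus_of_continuity \<delta> f \<le> ereal (C * \<omega> \<delta>)}"

end

theory Submission
  imports Defs
begin

text \<open>
  The modulus \<open>\<omega>(\<delta>) = sqrt \<delta>\<close> already does the job. Let \<open>h\<close> be a homeomorphism of the circle and
  let \<open>H\<close> be its lift to the line; after a reflection of the target circle \<open>H\<close> is increasing and
  \<open>H (t + 2 * pi) = H t + 2 * pi\<close>. If \<open>f\<close> on the circle corresponds to the periodic function \<open>F\<close>,
  then the coefficients of \<open>f \<circ> h\<close> are integrals of \<open>F (H t) * cis (- m * t)\<close>, and the claim follows once
  the functionals ``\<open>m\<close> times the \<open>m\<close>-th coefficient'' are not uniformly bounded on the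
  unit ball of the periodic functions with Hoelder exponent \<open>1/2\<close>: the principle of uniform boundedness
  (\<open>condensation_of_singularities\<close>) then provides one \<open>F\<close> in the ball on which they are unbounded.

  Unboundedness (\<open>scaled_coeff_unbounded\<close>) is a statement about one scale. Divide a period into \<open>N\<close>
  equal cells and let \<open>l p\<close> be the increment of \<open>H\<close> over the \<open>p\<close>-th cell. The increments add up to
  \<open>2 * pi\<close> and their maximum is small for large \<open>N\<close>. Hence for any given \<open>B\<close> some threshold \<open>d\<close> is reached by
  at least \<open>B / sqrt d\<close> of the increments; otherwise the \<open>j\<close>-th largest increment would be at most
  \<open>B\<^sup>2 / j\<^sup>2\<close>, and a summable majorant together with a small maximum makes the sum small
  (\<open>sum_le_if_few_large\<close>). Over each of these cells a Hoelder function has room to move by \<open>sqrt d\<close>,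
  and in the variable \<open>t\<close> this move takes no longer than one cell. Combine the large cells into
  pairs lying at least a fixed number of cells apart, and for each pair let \<open>F\<close> climb from \<open>0\<close> to
  \<open>\<plusminus> sqrt d / 2\<close> over the first cell and return to \<open>0\<close> over the second. For a frequency \<open>m\<close> that is
  small compared with \<open>N\<close>, the pair contributes, up to a unimodular factor, \<open>sqrt d / 2\<close> times the chord
  \<open>cis (m * D) - 1\<close>, where \<open>D\<close> is the distance in \<open>t\<close> between the two cells, up to a small error. Averaged over
  \<open>m = 1, \<dots>, M\<close> with \<open>N = 128 * M\<close>, each chord has length at least \<open>1/2\<close> (\<open>mean_chord_ge\<close>), so one \<open>m\<close> serves
  all pairs on average, and a choice of signs makes the contributions add up
  (\<open>signs_capture_half_of_norm_sum\<close>). The total is of the order of \<open>sqrt d\<close> times the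
  number of large cells, that is, at least a constant times \<open>B\<close>.
\<close>

section \<open>Uniform boundedness\<close>

text \<open>
  Uniform boundedness for functionals on a set \<open>K\<close> that plays the part of the closed unit ball of a
  Banach space: \<open>series\<close> expresses its completeness, convexity and symmetry at once. One adds
  multiples \<open>\<plusminus> (1/3) ^ (n + 1)\<close> of nearly norming elements \<open>f n\<close>, choosing each sign so that
  the \<open>n\<close>-th functional is at least as large at the new partial sum as at the added term; the remaining terms
  are too small to cancel this.
\<close>
lemma condensation_of_singularities:
  fixes K :: "('a \<Rightarrow> real) set" and \<Lambda> :: "'i \<Rightarrow> ('a \<Rightarrow> real) \<Rightarrow> complex"
  assumes series: "\<And>c f. \<lbrakk>\<And>n. f n \<in> K; summable (\<lambda>n. \<bar>c n\<bar>); (\<Sum>n. \<bar>c n\<bar>) \<le> 1\<rbrakk>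
      \<Longrightarrow> (\<forall>x. summable (\<lambda>n. c n * f n x)) \<and> (\<lambda>x. \<Sum>n. c n * f n x) \<in> K"
    and linear: "\<And>i f g a b. \<lbrakk>f \<in> K; g \<in> K\<rbrakk>
      \<Longrightarrow> \<Lambda> i (\<lambda>x. a * f x + b * g x) = of_real a * \<Lambda> i f + of_real b * \<Lambda> i g"
    and bounded: "\<And>i. bdd_above ((\<lambda>f. cmod (\<Lambda> i f)) ` K)"
    and unbounded: "\<And>B. \<exists>f\<in>K. \<exists>i. B \<le> cmod (\<Lambda> i f)"
  shows "\<exists>f\<in>K. \<forall>B. \<exists>i. B < cmod (\<Lambda> i f)"
proof -
  have "\<exists>f i. f \<in> K \<and> 4 ^ n \<le> cmod (\<Lambda> i f) \<and> (\<forall>g\<in>K. cmod (\<Lambda> i g) \<le> 4/3 * cmod (\<Lambda> i f))"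
    for n :: nat
  proof -
    obtain f0 i where f0: "f0 \<in> K" "4/3 * 4 ^ n \<le> cmod (\<Lambda> i f0)"
      using unbounded by blast
    define S where "S = (SUP f\<in>K. cmod (\<Lambda> i f))"
    have le_S: "cmod (\<Lambda> i g) \<le> S" if "g \<in> K" for g
      unfolding S_def by (rule cSUP_upper[OF that bounded])
    have "(0::real) < 4 ^ n" by simp
    then have S_ge: "4/3 * 4 ^ n \<le> S" using le_S[OF f0(1)] f0(2) by linarith
    then have "3/4 * S < S" using \<open>(0::real) < 4 ^ n\<close> by linarith
    then have "\<exists>f\<in>K. 3/4 * S < cmod (\<Lambda> i f)"
      unfolding S_def using f0(1) by (subst (asm) less_cSUP_iff[OF _ bounded]) auto
    then obtain f where f: "f \<in> K" "3/4 * S < cmod (\<Lambda> i f)" by blast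
    have "4 ^ n \<le> cmod (\<Lambda> i f)" using f(2) S_ge by linarith
    moreover have "cmod (\<Lambda> i g) \<le> 4/3 * cmod (\<Lambda> i f)" if "g \<in> K" for g
      using le_S[OF that] f(2) by linarith
    ultimately show ?thesis using f(1) by blast
  qed
  then obtain f i where fK: "\<And>n. f n \<in> K" and f_large: "\<And>n. 4 ^ n \<le> cmod (\<Lambda> (i n) (f n))"
    and near_norming: "\<And>n g. g \<in> K \<Longrightarrow> cmod (\<Lambda> (i n) g) \<le> 4/3 * cmod (\<Lambda> (i n) (f n))"
    by metis
  define r :: "nat \<Rightarrow> real" where "r = (\<lambda>n. (1/3) ^ Suc n)"
  have r_pos: "0 < r n" for n by (simp add: r_def)
  define sg where "sg = (\<lambda>n X. if cmod (\<Lambda> (i n) (\<lambda>x. 1 * X x + - r n * f n x))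
      \<le> cmod (\<Lambda> (i n) (\<lambda>x. 1 * X x + r n * f n x)) then r n else - r n)"
  define X :: "nat \<Rightarrow> 'a \<Rightarrow> real" where
    "X = rec_nat (\<lambda>x. 0) (\<lambda>n X x. 1 * X x + sg n X * f n x)"
  have X_0: "X 0 = (\<lambda>x. 0)" and X_Suc: "X (Suc n) = (\<lambda>x. 1 * X n x + sg n (X n) * f n x)" for n
    by (simp_all add: X_def)
  define c where "c = (\<lambda>n. sg n (X n))"
  have abs_c: "\<bar>c n\<bar> = r n" for n by (auto simp: c_def sg_def r_def)
  have X_sum: "X n = (\<lambda>x. \<Sum>j<n. c j * f j x)" for n
    by (induction n) (auto simp: X_0 X_Suc c_def)
  have r_sums: "r sums (1/2)"
  proof -
    have "(\<lambda>n. (1/3) * (1/3) ^ n) sums ((1/3) * (1 / (1 - 1/3 :: real)))"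
      by (intro sums_mult geometric_sums) simp
    then show ?thesis by (simp add: r_def)
  qed
  have c_summable: "summable (\<lambda>n. \<bar>c n\<bar>)" and c_le: "(\<Sum>n. \<bar>c n\<bar>) \<le> 1"
    using r_sums by (auto simp: abs_c sums_iff)
  define x where "x = (\<lambda>z. \<Sum>n. c n * f n z)"
  have xK: "x \<in> K" and x_summable: "\<And>z. summable (\<lambda>n. c n * f n z)"
    using series[of f c, OF fK c_summable c_le] by (auto simp: x_def)
  have XK: "X n \<in> K" for n
  proof -
    define c' where "c' = (\<lambda>j. if j < n then c j else 0)"
    have s: "summable (\<lambda>j. \<bar>c' j\<bar>)"
      by (rule summable_comparison_test'[OF c_summable, of 0]) (auto simp: c'_def)
    have "(\<Sum>j. \<bar>c' j\<bar>) \<le> (\<Sum>j. \<bar>c j\<bar>)"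
      by (rule suminf_le[OF _ s c_summable]) (auto simp: c'_def)
    then have "(\<Sum>j. \<bar>c' j\<bar>) \<le> 1" using c_le by linarith
    from series[of f c', OF fK s this] have "(\<lambda>z. \<Sum>j. c' j * f j z) \<in> K" by blast
    also have "(\<lambda>z. \<Sum>j. c' j * f j z) = (\<lambda>z. \<Sum>j<n. c' j * f j z)"
      by (intro ext suminf_finite) (auto simp: c'_def)
    also have "\<dots> = X n" unfolding X_sum by (intro ext sum.cong) (auto simp: c'_def)
    finally show ?thesis .
  qed
  \<comment> \<open>Of the two candidates \<open>X n \<plusminus> r n * f n\<close>, at least one is mapped by the \<open>n\<close>-th functional
     to a value no smaller than that of the perturbation.\<close>
  have step: "r n * cmod (\<Lambda> (i n) (f n)) \<le> cmod (\<Lambda> (i n) (X (Suc n)))" for n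
  proof -
    define u where "u = \<Lambda> (i n) (X n)"
    define v where "v = of_real (r n) * \<Lambda> (i n) (f n)"
    have p: "\<Lambda> (i n) (\<lambda>x. 1 * X n x + r n * f n x) = u + v"
      by (subst linear[OF XK fK]) (simp add: u_def v_def)
    have m: "\<Lambda> (i n) (\<lambda>x. 1 * X n x + - r n * f n x) = u - v"
      by (subst linear[OF XK fK]) (simp add: u_def v_def)
    have sgn: "sg n (X n) = (if cmod (u - v) \<le> cmod (u + v) then r n else - r n)"
      unfolding sg_def p m ..
    have "2 * cmod v = cmod ((u + v) - (u - v))"
      by (simp flip: mult_2 add: norm_mult)
    also have "\<dots> \<le> cmod (u + v) + cmod (u - v)" by (rule norm_triangle_ineq4)
    finally have "cmod v \<le> cmod (u + v) \<or> cmod v \<le> cmod (u - v)" by linarith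
    moreover have "cmod v = r n * cmod (\<Lambda> (i n) (f n))" using r_pos[of n] by (simp add: v_def norm_mult)
    moreover have "\<Lambda> (i n) (X (Suc n)) = (if cmod (u - v) \<le> cmod (u + v) then u + v else u - v)"
      using p m by (simp add: X_Suc sgn)
    ultimately show ?thesis by (auto split: if_splits)
  qed
  have lower: "(4/3) ^ n / 9 \<le> cmod (\<Lambda> (i n) x)" for n
  proof -
    define T where "T = cmod (\<Lambda> (i n) (f n))"
    define y where "y = (\<lambda>z. \<Sum>j. (2 / r n * c (j + Suc n)) * f (j + Suc n) z)"
    have tail: "(\<lambda>j. \<bar>2 / r n * c (j + Suc n)\<bar>) sums 1"
    proof -
      have "\<bar>2 / r n * c (j + Suc n)\<bar> = 2 * r j" for j
        by (simp add: abs_mult abs_c) (simp add: r_def field_simps power_add)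
      then show ?thesis using sums_mult[OF r_sums, of 2] by simp
    qed
    have yK: "y \<in> K"
      using series[of "\<lambda>j. f (j + Suc n)" "\<lambda>j. 2 / r n * c (j + Suc n)"] fK tail
      unfolding y_def by (simp add: sums_iff)
    have "x z = 1 * X (Suc n) z + (r n / 2) * y z" for z
    proof -
      have sm: "summable (\<lambda>j. c (j + Suc n) * f (j + Suc n) z)"
        using x_summable[of z] by (subst summable_iff_shift)
      have "x z = (\<Sum>j. c (j + Suc n) * f (j + Suc n) z) + (\<Sum>j<Suc n. c j * f j z)"
        unfolding x_def by (rule suminf_split_initial_segment[OF x_summable])
      moreover have "y z = 2 / r n * (\<Sum>j. c (j + Suc n) * f (j + Suc n) z)"
        unfolding y_def by (subst suminf_mult[symmetric, OF sm]) (simp add: mult.assoc)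
      moreover have "r n \<noteq> 0" by (simp add: r_def)
      ultimately show ?thesis unfolding X_sum by simp
    qed
    then have "x = (\<lambda>z. 1 * X (Suc n) z + (r n / 2) * y z)" by blast
    then have "\<Lambda> (i n) x = \<Lambda> (i n) (X (Suc n)) + of_real (r n / 2) * \<Lambda> (i n) y"
      using linear[OF XK yK, of "i n" 1 "Suc n" "r n / 2"] by simp
    then have "cmod (\<Lambda> (i n) (X (Suc n))) - cmod (of_real (r n / 2) * \<Lambda> (i n) y) \<le> cmod (\<Lambda> (i n) x)"
      by (metis norm_diff_ineq)
    moreover have "cmod (of_real (r n / 2) * \<Lambda> (i n) y) \<le> r n / 2 * (4/3 * T)"
      unfolding norm_mult T_def using near_norming[OF yK, of n]
      using r_pos[of n] by (intro mult_mono) auto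
    moreover have "r n * T \<le> cmod (\<Lambda> (i n) (X (Suc n)))" using step by (simp add: T_def)
    ultimately have "r n * T / 3 \<le> cmod (\<Lambda> (i n) x)" by (simp add: field_simps)
    moreover have "r n * 4 ^ n \<le> r n * T"
      using f_large[of n] by (intro mult_left_mono) (auto simp: T_def less_imp_le[OF r_pos])
    moreover have "r n * 4 ^ n / 3 = (4/3) ^ n / 9" by (simp add: r_def field_simps)
    ultimately show ?thesis by linarith
  qed
  have "\<exists>j. B < cmod (\<Lambda> j x)" for B
  proof -
    obtain n where "9 * B < (4/3) ^ n" using real_arch_pow[of "4/3" "9 * B"] by auto
    then show ?thesis using lower[of n] by (intro exI[of _ "i n"]) linarith
  qed
  then show ?thesis using xK by blast
qed

section \<open>Finite sums and selections\<close>

text \<open>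
  The hypothesis on the counts bounds the \<open>j\<close>-th largest value by \<open>B\<^sup>2 / j\<^sup>2\<close>. The first \<open>J\<close> values are estimated
  by \<open>\<eta>\<close> and the others by the telescoping bound \<open>1 / j\<^sup>2 \<le> 1 / (j - 1) - 1 / j\<close>; the induction
  strips off the smallest value.
\<close>
lemma sum_le_if_few_large:
  fixes l :: "'a \<Rightarrow> real"
  assumes "finite P" and "J \<ge> 1" and "0 \<le> \<eta>"
    and "\<And>p. p \<in> P \<Longrightarrow> 0 \<le> l p \<and> l p \<le> \<eta>"
    and "\<And>d. 0 < d \<Longrightarrow> card {p \<in> P. d \<le> l p} * sqrt d \<le> B"
  shows "sum l P \<le> real J * \<eta> + B\<^sup>2 / real J"
proof -
  have *: "\<And>P. \<lbrakk>finite P; card P = n; \<And>p. p \<in> P \<Longrightarrow> 0 \<le> l p \<and> l p \<le> \<eta>;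
      \<And>d. 0 < d \<Longrightarrow> card {p \<in> P. d \<le> l p} * sqrt d \<le> B; J \<le> n\<rbrakk>
      \<Longrightarrow> sum l P \<le> real J * \<eta> + B\<^sup>2 * (1 / real J - 1 / real n)" for n
  proof (induction n)
    case 0
    then show ?case using \<open>J \<ge> 1\<close> by simp
  next
    case (Suc n)
    show ?case
    proof (cases "J = Suc n")
      case True
      have "sum l P \<le> real (card P) * \<eta>" by (rule sum_bounded_above) (use Suc.prems in auto)
      then show ?thesis using True Suc.prems by simp
    next
      case False
      then have Jn: "J \<le> n" "n \<ge> 1" using Suc.prems \<open>J \<ge> 1\<close> by auto
      have ne: "l ` P \<noteq> {}" using Suc.prems by auto
      have fin: "finite (l ` P)" using Suc.prems by auto
      obtain p where p: "p \<in> P" "l p = Min (l ` P)" using Min_in[OF fin ne] by force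
      have le: "l p \<le> l q" if "q \<in> P" for q using that p(2) fin by simp
      have "sum l (P - {p}) \<le> real J * \<eta> + B\<^sup>2 * (1 / real J - 1 / real n)"
      proof (rule Suc.IH)
        show "card {q \<in> P - {p}. d \<le> l q} * sqrt d \<le> B" if "0 < d" for d
        proof -
          have "card {q \<in> P - {p}. d \<le> l q} \<le> card {q \<in> P. d \<le> l q}"
            by (rule card_mono) (use Suc.prems in auto)
          then have "card {q \<in> P - {p}. d \<le> l q} * sqrt d \<le> card {q \<in> P. d \<le> l q} * sqrt d"
            using that by (intro mult_right_mono) auto
          then show ?thesis using Suc.prems(4)[OF that] by linarith
        qed
      qed (use Suc.prems p Jn in auto)
      moreover have "l p \<le> B\<^sup>2 * (1 / real n - 1 / real (Suc n))"
      proof (cases "l p = 0")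
        case True
        then show ?thesis using Jn by (simp add: field_simps)
      next
        case False
        then have pos: "0 < l p" using Suc.prems(3)[OF p(1)] by linarith
        have "{q \<in> P. l p \<le> l q} = P" using le by auto
        then have "real (Suc n) * sqrt (l p) \<le> B" using Suc.prems(4)[OF pos] Suc.prems(2) by simp
        then have "(real (Suc n) * sqrt (l p))\<^sup>2 \<le> B\<^sup>2" using pos by (intro power_mono) auto
        then have "(real (Suc n))\<^sup>2 * l p \<le> B\<^sup>2" using pos by (simp add: power_mult_distrib)
        then have "l p \<le> B\<^sup>2 / (real (Suc n))\<^sup>2" by (simp add: field_simps)
        also have "\<dots> \<le> B\<^sup>2 / (real n * real (Suc n))"
          using Jn by (intro divide_left_mono) (auto simp: power2_eq_square)
        also have "\<dots> = B\<^sup>2 * (1 / real n - 1 / real (Suc n))"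
          using Jn by (simp add: field_simps)
        finally show ?thesis .
      qed
      moreover have "sum l P = l p + sum l (P - {p})" using Suc.prems p by (simp add: sum.remove)
      ultimately show ?thesis by (simp add: algebra_simps)
    qed
  qed
  show ?thesis
  proof (cases "J \<le> card P")
    case True
    have "sum l P \<le> real J * \<eta> + B\<^sup>2 * (1 / real J - 1 / real (card P))"
      using assms True by (intro *) auto
    also have "\<dots> \<le> real J * \<eta> + B\<^sup>2 / real J" by (simp add: algebra_simps)
    finally show ?thesis .
  next
    case False
    have "sum l P \<le> real (card P) * \<eta>" by (rule sum_bounded_above) (use assms in auto)
    also have "\<dots> \<le> real J * \<eta>" using False \<open>0 \<le> \<eta>\<close> by (intro mult_right_mono) auto
    also have "\<dots> \<le> real J * \<eta> + B\<^sup>2 / real J" by simp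
    finally show ?thesis .
  qed
qed

text \<open>
  When \<open>D\<close> keeps a distance of \<open>pi / M\<close> from the multiples of \<open>2 * pi\<close>, the Dirichlet kernel keeps the
  sum of the \<open>cos (m * D)\<close> below \<open>M / 2\<close>, so the squared chords \<open>2 - 2 * cos (m * D)\<close> are at least \<open>1\<close> on
  average. As no chord exceeds \<open>2\<close>, its length is at least half of its square.
\<close>
lemma mean_chord_ge:
  fixes M :: nat and D :: real
  assumes M: "M \<ge> 1" and D: "pi / M \<le> D" "D \<le> 2 * pi - pi / M"
  shows "real M / 2 \<le> (\<Sum>m=1..M. cmod (cis (m * D) - 1))"
proof -
  have cos_sum: "2 * sin (D/2) * (\<Sum>m=1..K. cos (m * D)) = sin ((K + 1/2) * D) - sin (D/2)" for K :: nat
  proof (induction K)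
    case (Suc K)
    have "2 * sin (D/2) * cos (Suc K * D) = sin (D/2 + Suc K * D) - sin (Suc K * D - D/2)"
      by (simp add: sin_add sin_diff)
    moreover have "Suc K * D - D/2 = (K + 1/2) * D" "D/2 + Suc K * D = (Suc K + 1/2) * D"
      by (simp_all add: field_simps)
    ultimately have "2 * sin (D/2) * cos (Suc K * D) = sin ((Suc K + 1/2) * D) - sin ((K + 1/2) * D)"
      by simp
    then show ?case using Suc by (simp add: distrib_left)
  qed (simp add: field_simps)
  have sin_ge: "1 / M \<le> sin (D/2)"
  proof -
    have jordan: "2 / pi * x \<le> sin x" if "0 \<le> x" "x \<le> pi/2" for x
    proof -
      have conc: "concave_on {0..pi/2} sin"
        by (rule f''_le0_imp_concave[where f' = cos and f'' = "\<lambda>x. - sin x"])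
           (auto intro!: derivative_eq_intros sin_ge_zero)
      have "(1 - 2 / pi * x) * sin 0 + 2 / pi * x * sin (pi/2)
          \<le> sin ((1 - 2 / pi * x) *\<^sub>R 0 + (2 / pi * x) *\<^sub>R (pi/2))"
        using that by (intro concave_onD[OF conc]) (auto simp: field_simps)
      then show ?thesis by simp
    qed
    define x where "x = pi / (2 * M)"
    have x: "0 \<le> x" "x \<le> pi / 2" using M by (auto simp: x_def field_simps)
    have "1 / M = 2 / pi * x" by (simp add: x_def)
    also have "\<dots> \<le> sin x" using x by (rule jordan)
    also have "\<dots> \<le> sin (D/2)"
    proof (cases "D/2 \<le> pi/2")
      case True
      moreover have "x \<le> D/2" using D by (simp add: x_def)
      ultimately show ?thesis using x pi_gt_zero by (intro sin_monotone_2pi_le) linarith+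
    next
      case False
      moreover have "x \<le> pi - D/2" using D by (simp add: x_def)
      ultimately have "sin x \<le> sin (pi - D/2)"
        using x pi_gt_zero by (intro sin_monotone_2pi_le) linarith+
      then show ?thesis by simp
    qed
    finally show ?thesis .
  qed
  have "0 < 1 / real M" using M by simp
  then have pos: "0 < sin (D/2)" using sin_ge by linarith
  have cos_le: "(\<Sum>m=1..M. cos (m * D)) \<le> M / 2"
  proof -
    have "2 * sin (D/2) * (\<Sum>m=1..M. cos (m * D)) \<le> 1"
      unfolding cos_sum using pos sin_le_one[of "(M + 1/2) * D"] by linarith
    also have "1 = 2 * (1/M) * (real M / 2)" using M by simp
    also have "\<dots> \<le> 2 * sin (D/2) * (M/2)" using sin_ge by (intro mult_right_mono) auto
    finally show ?thesis using pos by simp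
  qed
  have sq: "(cmod (cis \<theta> - 1))\<^sup>2 = 2 - 2 * cos \<theta>" for \<theta> :: real
    using sin_cos_squared_add[of \<theta>] by (simp add: cmod_power2 power2_diff)
  have "1 - cos (m * D) \<le> cmod (cis (m * D) - 1)" for m :: nat
  proof -
    have "cmod (cis (m * D) - 1) \<le> cmod (cis (m*D)) + cmod 1" by (rule norm_triangle_ineq4)
    then have "cmod (cis (m * D) - 1) * cmod (cis (m * D) - 1) \<le> 2 * cmod (cis (m * D) - 1)"
      by (intro mult_right_mono) auto
    then show ?thesis using sq[of "m * D"] by (simp add: power2_eq_square)
  qed
  then have "(\<Sum>m=1..M. 1 - cos (m * D)) \<le> (\<Sum>m=1..M. cmod (cis (m * D) - 1))"
    by (intro sum_mono)
  then show ?thesis using cos_le by (simp add: sum_subtractf)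
qed

text \<open>
  Aligning the signs with the real parts or with the imaginary parts captures the corresponding half of
  \<open>\<bar>Re w\<bar> + \<bar>Im w\<bar> \<ge> cmod w\<close>; the better of the two choices suffices.
\<close>
lemma signs_capture_half_of_norm_sum:
  fixes w :: "'a \<Rightarrow> complex"
  shows "\<exists>s::'a \<Rightarrow> real. (\<forall>i. \<bar>s i\<bar> = 1) \<and> (\<Sum>i\<in>I. cmod (w i)) / 2 \<le> cmod (\<Sum>i\<in>I. of_real (s i) * w i)"
proof -
  define sr where "sr = (\<lambda>i. if 0 \<le> Re (w i) then 1 else - 1 :: real)"
  define si where "si = (\<lambda>i. if 0 \<le> Im (w i) then 1 else - 1 :: real)"
  have "(\<Sum>i\<in>I. cmod (w i)) \<le> (\<Sum>i\<in>I. \<bar>Re (w i)\<bar> + \<bar>Im (w i)\<bar>)"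
    by (intro sum_mono cmod_le)
  also have "\<dots> = (\<Sum>i\<in>I. sr i * Re (w i)) + (\<Sum>i\<in>I. si i * Im (w i))"
    by (subst sum.distrib) (auto simp: sr_def si_def intro!: arg_cong2[of _ _ _ _ "(+)"] sum.cong)
  also have "(\<Sum>i\<in>I. sr i * Re (w i)) = Re (\<Sum>i\<in>I. of_real (sr i) * w i)" by simp
  also have "(\<Sum>i\<in>I. si i * Im (w i)) = Im (\<Sum>i\<in>I. of_real (si i) * w i)" by simp
  finally have "(\<Sum>i\<in>I. cmod (w i)) \<le>
      cmod (\<Sum>i\<in>I. of_real (sr i) * w i) + cmod (\<Sum>i\<in>I. of_real (si i) * w i)"
    using complex_Re_le_cmod[of "\<Sum>i\<in>I. of_real (sr i) * w i"]
      abs_Im_le_cmod[of "\<Sum>i\<in>I. of_real (si i) * w i"] by linarith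
  then have "(\<Sum>i\<in>I. cmod (w i)) / 2 \<le> cmod (\<Sum>i\<in>I. of_real (sr i) * w i)
      \<or> (\<Sum>i\<in>I. cmod (w i)) / 2 \<le> cmod (\<Sum>i\<in>I. of_real (si i) * w i)" by linarith
  moreover have "\<forall>i. \<bar>sr i\<bar> = 1" "\<forall>i. \<bar>si i\<bar> = 1" by (auto simp: sr_def si_def)
  ultimately show ?thesis by blast
qed

text \<open>
  In the increasing enumeration of \<open>P\<close>, elements \<open>g\<close> places apart differ by at least \<open>g\<close>. From each block of
  \<open>2 * g\<close> consecutive elements the pair consists of the first one and of the one \<open>g\<close> places later.
\<close>
lemma separated_pairs:
  fixes P :: "nat set"
  assumes "finite P" "g \<ge> 1"
  shows "\<exists>p q. \<forall>i < card P div (2 * g). p i \<in> P \<and> q i \<in> P \<and> p i + g \<le> q i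
    \<and> (\<forall>j < card P div (2 * g). i < j \<longrightarrow> q i < p j)"
proof -
  define e where "e = (\<lambda>i. sorted_list_of_set P ! i)"
  have e_in: "e i \<in> P" if "i < card P" for i
    unfolding e_def using that assms by (metis length_sorted_list_of_set nth_mem set_sorted_list_of_set)
  have e_less: "e i < e j" if "i < j" "j < card P" for i j
    unfolding e_def using that assms
    by (intro sorted_wrt_nth_less[OF strict_sorted_list_of_set]) auto
  have e_add: "e i + k \<le> e (i + k)" if "i + k < card P" for i k
    using that
  proof (induction k)
    case (Suc k)
    then show ?case using e_less[of "i + k" "i + Suc k"] by simp
  qed simp
  have bound: "2 * g * i + 2 * g \<le> card P" if "i < card P div (2 * g)" for i
  proof -
    have "2 * g * Suc i \<le> 2 * g * (card P div (2 * g))" using that by (intro mult_left_mono) auto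
    also have "\<dots> \<le> card P" by simp
    finally show ?thesis by simp
  qed
  have *: "e (2*g*i) \<in> P \<and> e (2*g*i+g) \<in> P \<and> e (2*g*i) + g \<le> e (2*g*i+g)
    \<and> (\<forall>j < card P div (2 * g). i < j \<longrightarrow> e (2*g*i+g) < e (2*g*j))"
    if i: "i < card P div (2 * g)" for i
  proof (intro conjI allI impI)
    show "e (2*g*i) \<in> P" "e (2*g*i+g) \<in> P" "e (2*g*i) + g \<le> e (2*g*i+g)"
      using bound[OF i] assms by (auto intro!: e_in e_add)
    fix j assume j: "j < card P div (2 * g)" "i < j"
    have "2*g*Suc i \<le> 2*g*j" using j by (intro mult_left_mono) auto
    then show "e (2*g*i+g) < e (2*g*j)" using bound[OF j(1)] assms by (intro e_less) auto
  qed
  show ?thesis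
    by (rule exI[of _ "\<lambda>i. e (2*g*i)"], rule exI[of _ "\<lambda>i. e (2*g*i+g)"]) (intro allI impI *)
qed

section \<open>The Hoelder ball and the scaled Fourier coefficients\<close>

definition hoelder_ball :: "(real \<Rightarrow> real) set" where
  "hoelder_ball = {F. (\<forall>x. \<bar>F x\<bar> \<le> 1) \<and> (\<forall>x y. \<bar>F x - F y\<bar> \<le> sqrt \<bar>x - y\<bar>)
     \<and> (\<forall>x. \<forall>k::int. F (x + 2 * pi * k) = F x)}"

lemma hoelder_ballD:
  assumes "F \<in> hoelder_ball"
  shows "\<bar>F x\<bar> \<le> 1" "\<bar>F x - F y\<bar> \<le> sqrt \<bar>x - y\<bar>" "F (x + 2 * pi * of_int k) = F x"
  using assms by (auto simp: hoelder_ball_def)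

lemma hoelder_ball_continuous:
  assumes "F \<in> hoelder_ball"
  shows "continuous_on S F"
proof (rule continuous_at_imp_continuous_on, rule ballI)
  fix x
  have "((\<lambda>y. F y - F x) \<longlongrightarrow> 0) (at x)"
  proof (rule Lim_null_comparison[where g = "\<lambda>y. sqrt \<bar>y - x\<bar>"])
    show "\<forall>\<^sub>F y in at x. norm (F y - F x) \<le> sqrt \<bar>y - x\<bar>"
      using hoelder_ballD(2)[OF assms] by simp
    have "((\<lambda>y. sqrt \<bar>y - x\<bar>) \<longlongrightarrow> sqrt \<bar>x - x\<bar>) (at x)" by (intro tendsto_intros)
    then show "((\<lambda>y. sqrt \<bar>y - x\<bar>) \<longlongrightarrow> 0) (at x)" by simp
  qed
  then show "isCont F x" by (simp add: isCont_def LIM_zero_iff)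
qed

text \<open>
  All the defining conditions of the ball are bounds or equations for linear functionals of \<open>F\<close> that pass to absolutely
  convergent sums.
\<close>
lemma hoelder_ball_series:
  assumes f: "\<And>n. f n \<in> hoelder_ball" and c: "summable (\<lambda>n. \<bar>c n\<bar>)" "(\<Sum>n. \<bar>c n\<bar>) \<le> 1"
  shows "(\<forall>x. summable (\<lambda>n. c n * f n x)) \<and> (\<lambda>x. \<Sum>n. c n * f n x) \<in> hoelder_ball"
proof -
  have sm: "summable (\<lambda>n. c n * f n x)" for x
  proof (rule summable_comparison_test'[OF c(1), of 0])
    show "norm (c n * f n x) \<le> \<bar>c n\<bar>" for n
      using mult_left_mono[OF hoelder_ballD(1)[OF f], of "\<bar>c n\<bar>"] by (simp add: abs_mult)
  qed
  have bound: "\<bar>\<Sum>n. c n * a n\<bar> \<le> b" if "\<And>n. \<bar>a n\<bar> \<le> b" for a b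
  proof -
    have le: "\<bar>c n * a n\<bar> \<le> \<bar>c n\<bar> * b" for n
      using mult_left_mono[OF that[of n], of "\<bar>c n\<bar>"] by (simp add: abs_mult)
    have s: "summable (\<lambda>n. \<bar>c n * a n\<bar>)"
      by (rule summable_comparison_test'[OF summable_mult2[OF c(1), of b], of 0]) (use le in auto)
    have "\<bar>\<Sum>n. c n * a n\<bar> \<le> (\<Sum>n. \<bar>c n * a n\<bar>)" by (rule summable_rabs[OF s])
    also have "\<dots> \<le> (\<Sum>n. \<bar>c n\<bar> * b)" by (rule suminf_le[OF le s summable_mult2[OF c(1)]])
    also have "\<dots> = (\<Sum>n. \<bar>c n\<bar>) * b" by (rule suminf_mult2[OF c(1), symmetric])
    also have "\<dots> \<le> 1 * b"
      by (intro mult_right_mono c(2)) (use that[of 0] in linarith)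
    finally show ?thesis by simp
  qed
  have "\<bar>(\<Sum>n. c n * f n x) - (\<Sum>n. c n * f n y)\<bar> \<le> sqrt \<bar>x - y\<bar>" for x y
  proof -
    have "(\<Sum>n. c n * f n x) - (\<Sum>n. c n * f n y) = (\<Sum>n. c n * (f n x - f n y))"
      by (subst suminf_diff[OF sm sm]) (simp add: algebra_simps)
    moreover have "\<bar>\<Sum>n. c n * (f n x - f n y)\<bar> \<le> sqrt \<bar>x - y\<bar>"
      by (rule bound) (rule hoelder_ballD(2)[OF f])
    ultimately show ?thesis by (simp only:)
  qed
  moreover have "\<bar>\<Sum>n. c n * f n x\<bar> \<le> 1" for x
    by (rule bound) (rule hoelder_ballD(1)[OF f])
  moreover have "(\<Sum>n. c n * f n (x + 2 * pi * of_int k)) = (\<Sum>n. c n * f n x)" for x and k :: int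
    by (simp only: hoelder_ballD(3)[OF f])
  ultimately show ?thesis using sm unfolding hoelder_ball_def by blast
qed

text \<open>
  Up to the factor \<open>2 * pi\<close>, this is \<open>m\<close> times the \<open>m\<close>-th Fourier coefficient of \<open>F \<circ> H\<close>.
\<close>
definition scaled_coeff :: "(real \<Rightarrow> real) \<Rightarrow> nat \<Rightarrow> (real \<Rightarrow> real) \<Rightarrow> complex" where
  "scaled_coeff H m F = of_nat m * integral {0..2*pi} (\<lambda>t. of_real (F (H t)) * cis (- (real m * t)))"

lemma continuous_on_cis_mult: "continuous_on S (\<lambda>t. cis (- (c * t)))"
  unfolding cis_conv_exp by (intro continuous_intros)

lemma scaled_coeff_integrable:
  fixes H F :: "real \<Rightarrow> real"
  assumes "continuous_on UNIV H" "continuous_on UNIV F"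
  shows "(\<lambda>t. of_real (F (H t)) * cis (- (real m * t))) integrable_on {0..2*pi}"
proof (rule integrable_continuous_interval)
  have "continuous_on {0..2*pi} (\<lambda>t. F (H t))"
    by (rule continuous_on_compose2[OF assms(2)]) (use assms(1) continuous_on_subset in auto)
  then show "continuous_on {0..2*pi} (\<lambda>t. of_real (F (H t)) * cis (- (real m * t)))"
    by (intro continuous_intros continuous_on_cis_mult)
qed

lemma scaled_coeff_sum:
  assumes "continuous_on UNIV H" "\<And>i. i \<in> I \<Longrightarrow> continuous_on UNIV (\<phi> i)" "finite I"
  shows "scaled_coeff H m (\<lambda>x. \<Sum>i\<in>I. s i * \<phi> i x) = (\<Sum>i\<in>I. of_real (s i) * scaled_coeff H m (\<phi> i))"
proof -
  have "integral {0..2*pi} (\<lambda>t. of_real (\<Sum>i\<in>I. s i * \<phi> i (H t)) * cis (- (real m * t)))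
      = integral {0..2*pi} (\<lambda>t. \<Sum>i\<in>I. of_real (s i) * (of_real (\<phi> i (H t)) * cis (- (real m * t))))"
    by (simp add: sum_distrib_right mult.assoc)
  also have "\<dots> = (\<Sum>i\<in>I. integral {0..2*pi}
      (\<lambda>t. of_real (s i) * (of_real (\<phi> i (H t)) * cis (- (real m * t)))))"
    using assms by (intro integral_sum integrable_on_mult_right scaled_coeff_integrable) auto
  also have "\<dots> = (\<Sum>i\<in>I. of_real (s i) * integral {0..2*pi}
      (\<lambda>t. of_real (\<phi> i (H t)) * cis (- (real m * t))))"
    by (intro sum.cong integral_mult_right refl)
  finally have eq: "integral {0..2*pi} (\<lambda>t. of_real (\<Sum>i\<in>I. s i * \<phi> i (H t)) * cis (- (real m * t)))
    = (\<Sum>i\<in>I. of_real (s i) * integral {0..2*pi} (\<lambda>t. of_real (\<phi> i (H t)) * cis (- (real m * t))))" .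
  show ?thesis
    unfolding scaled_coeff_def eq sum_distrib_left by (intro sum.cong refl mult.left_commute)
qed

lemma norm_scaled_coeff_le:
  assumes H: "continuous_on UNIV H" and F: "F \<in> hoelder_ball"
  shows "cmod (scaled_coeff H m F) \<le> 2 * pi * m"
proof -
  have "continuous_on {0..2*pi} (\<lambda>t. F (H t))"
    by (rule continuous_on_compose2[OF hoelder_ball_continuous[OF F, of UNIV]])
       (use H continuous_on_subset in auto)
  then have "cmod (integral {0..2*pi} (\<lambda>t. of_real (F (H t)) * cis (- (real m * t)))) \<le> 1 * (2 * pi - 0)"
    by (intro integral_bound continuous_intros continuous_on_cis_mult)
       (use hoelder_ballD(1)[OF F] in \<open>auto simp: norm_mult\<close>)
  then have "real m * cmod (integral {0..2*pi} (\<lambda>t. of_real (F (H t)) * cis (- (real m * t))))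
      \<le> real m * (2 * pi)" by (intro mult_left_mono) auto
  then show ?thesis by (simp add: scaled_coeff_def norm_mult mult_ac)
qed

text \<open>
  However \<open>g\<close> moves between its zero set and its plateau \<open>{b..c}\<close>, the two flanks
  contribute no more than their lengths. Hence the behaviour of a homeomorphism inside a cell,
  however wild, affects a coefficient only through the length of the cell.
\<close>
lemma norm_integral_plateau_le:
  fixes g :: "real \<Rightarrow> real" and E :: "real \<Rightarrow> complex"
  assumes ord: "u \<le> a" "a \<le> b" "b \<le> c" "c \<le> d" "d \<le> v"
    and cont: "continuous_on {u..v} g" "continuous_on {u..v} E"
    and E: "\<And>t. cmod (E t) \<le> 1"
    and g: "\<And>t. 0 \<le> g t \<and> g t \<le> 1"
    and g_0: "\<And>t. t \<in> {u..v} \<Longrightarrow> t \<notin> {a<..<d} \<Longrightarrow> g t = 0"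
    and g_1: "\<And>t. t \<in> {b..c} \<Longrightarrow> g t = 1"
  shows "cmod (integral {u..v} (\<lambda>t. of_real (g t) * E t) - integral {b..c} E) \<le> (b - a) + (d - c)"
proof -
  let ?f = "\<lambda>t. of_real (g t) * E t"
  have cf: "continuous_on {x..y} ?f" if "u \<le> x" "y \<le> v" for x y
  proof -
    have "continuous_on {u..v} ?f" using cont by (intro continuous_intros)
    then show ?thesis by (rule continuous_on_subset) (use that in auto)
  qed
  then have int: "?f integrable_on {x..y}" if "u \<le> x" "y \<le> v" for x y
    using that by (intro integrable_continuous_interval)
  have comb: "integral {x..z} ?f = integral {x..y} ?f + integral {y..z} ?f"
    if "u \<le> x" "x \<le> y" "y \<le> z" "z \<le> v" for x y z
    using that int[of x z] by (intro Henstock_Kurzweil_Integration.integral_combine[symmetric]) auto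
  have bd: "cmod (integral {x..y} ?f) \<le> y - x" if "u \<le> x" "x \<le> y" "y \<le> v" for x y
  proof -
    have "cmod (?f t) \<le> 1" for t
      using mult_mono[of "\<bar>g t\<bar>" 1 "cmod (E t)" 1] E[of t] g[of t] by (simp add: norm_mult)
    then have "cmod (integral {x..y} ?f) \<le> 1 * (y - x)"
      using that cf[of x y] by (intro integral_bound) auto
    then show ?thesis by simp
  qed
  have zero: "integral {x..y} ?f = 0" if "\<And>t. t \<in> {x..y} \<Longrightarrow> g t = 0" for x y
  proof -
    have "integral {x..y} ?f = integral {x..y} (\<lambda>t. 0)"
      by (rule Henstock_Kurzweil_Integration.integral_cong) (use that in auto)
    then show ?thesis by simp
  qed
  have "integral {u..v} ?f = integral {u..a} ?f + (integral {a..b} ?f + (integral {b..c} ?f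
      + (integral {c..d} ?f + integral {d..v} ?f)))"
  proof -
    have "integral {u..v} ?f = integral {u..a} ?f + integral {a..v} ?f" using ord by (intro comb) auto
    also have "integral {a..v} ?f = integral {a..b} ?f + integral {b..v} ?f" using ord by (intro comb) auto
    also have "integral {b..v} ?f = integral {b..c} ?f + integral {c..v} ?f" using ord by (intro comb) auto
    also have "integral {c..v} ?f = integral {c..d} ?f + integral {d..v} ?f" using ord by (intro comb) auto
    finally show ?thesis .
  qed
  moreover have "integral {u..a} ?f = 0" using ord by (intro zero g_0) auto
  moreover have "integral {d..v} ?f = 0" using ord by (intro zero g_0) auto
  moreover have "integral {b..c} ?f = integral {b..c} E"
    by (rule Henstock_Kurzweil_Integration.integral_cong) (use g_1 in auto)
  ultimately have "integral {u..v} ?f - integral {b..c} E = integral {a..b} ?f + integral {c..d} ?f"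
    by simp
  also have "cmod \<dots> \<le> cmod (integral {a..b} ?f) + cmod (integral {c..d} ?f)"
    by (rule norm_triangle_ineq)
  also have "\<dots> \<le> (b - a) + (d - c)" using ord bd[of a b] bd[of c d] by simp
  finally show ?thesis .
qed

lemma norm_integral_cis:
  assumes "b \<le> c"
  shows "real m * cmod (integral {b..c} (\<lambda>t. cis (- (real m * t)))) = cmod (cis (real m * (c - b)) - 1)"
proof -
  let ?G = "\<lambda>t::real. \<i> * exp (- \<i> * of_nat m * of_real t)"
  have "((\<lambda>t. of_nat m * exp (- \<i> * of_nat m * of_real t)) has_integral (?G c - ?G b)) {b..c}"
    using assms
  proof (intro fundamental_theorem_of_calculus)
    fix x
    have "((\<lambda>z. \<i> * exp (- \<i> * of_nat m * z)) has_field_derivative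
        of_nat m * exp (- \<i> * of_nat m * of_real x)) (at (of_real x))"
      by (auto intro!: derivative_eq_intros simp: mult_ac)
    then show "(?G has_vector_derivative of_nat m * exp (- \<i> * of_nat m * of_real x)) (at x within {b..c})"
      by (rule has_vector_derivative_real_field)
  qed
  moreover have "exp (- \<i> * of_nat m * of_real t) = cis (- (real m * t))" for t :: real
    by (simp add: cis_conv_exp mult.assoc)
  ultimately have "((\<lambda>t. of_nat m * cis (- (real m * t))) has_integral
      (\<i> * cis (- (real m * c)) - \<i> * cis (- (real m * b)))) {b..c}"
    by simp
  then have "integral {b..c} (\<lambda>t. of_nat m * cis (- (real m * t)))
      = \<i> * (cis (- (real m * c)) - cis (- (real m * b)))"
    by (simp only: integral_unique right_diff_distrib)
  then have "of_nat m * integral {b..c} (\<lambda>t. cis (- (real m * t)))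
      = \<i> * (cis (- (real m * c)) - cis (- (real m * b)))"
    by simp
  then have "cmod (of_nat m * integral {b..c} (\<lambda>t. cis (- (real m * t))))
      = cmod (\<i> * (cis (- (real m * c)) - cis (- (real m * b))))"
    by (rule arg_cong)
  then have "real m * cmod (integral {b..c} (\<lambda>t. cis (- (real m * t))))
      = cmod (cis (- (real m * c)) - cis (- (real m * b)))"
    by (simp only: norm_mult norm_of_nat norm_ii mult_1)
  also have "cis (- (real m * c)) - cis (- (real m * b))
      = - (cis (- (real m * c)) * (cis (real m * (c - b)) - 1))"
    by (simp add: algebra_simps cis_mult)
  also have "cmod \<dots> = cmod (cis (real m * (c - b)) - 1)" by (simp add: norm_mult)
  finally show ?thesis .
qed

section \<open>Periodic bumps\<close>

text \<open>
  A periodic trapezoid with flanks of slope \<open>1 / d\<close> over the translates of \<open>{\<alpha><..<\<beta>}\<close> by multiples of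
  \<open>2 * pi\<close>. Defined through the distance to the complement of these translates, it is
  Lipschitz and periodic by construction.
\<close>
definition bump :: "real \<Rightarrow> real \<Rightarrow> real \<Rightarrow> real \<Rightarrow> real" where
  "bump \<alpha> \<beta> d x = min 1 (infdist x {x. \<forall>k::int. x + 2 * pi * k \<notin> {\<alpha><..<\<beta>}} / d)"

lemma bump_bounds: "0 < d \<Longrightarrow> 0 \<le> bump \<alpha> \<beta> d x \<and> bump \<alpha> \<beta> d x \<le> 1"
  by (simp add: bump_def infdist_nonneg)

lemma bump_lipschitz:
  assumes "0 < d"
  shows "\<bar>bump \<alpha> \<beta> d x - bump \<alpha> \<beta> d y\<bar> \<le> \<bar>x - y\<bar> / d"
proof -
  let ?S = "{x. \<forall>k::int. x + 2 * pi * k \<notin> {\<alpha><..<\<beta>}}"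
  have "\<bar>bump \<alpha> \<beta> d x - bump \<alpha> \<beta> d y\<bar> \<le> \<bar>infdist x ?S / d - infdist y ?S / d\<bar>"
    unfolding bump_def by linarith
  also have "\<dots> = \<bar>infdist x ?S - infdist y ?S\<bar> / d"
    using assms by (simp flip: diff_divide_distrib)
  also have "\<dots> \<le> \<bar>x - y\<bar> / d"
    using infdist_triangle_abs[of x ?S y] assms by (intro divide_right_mono) (auto simp: dist_real_def)
  finally show ?thesis .
qed

lemma bump_continuous:
  assumes "0 < d"
  shows "continuous_on S (bump \<alpha> \<beta> d)"
  unfolding bump_def using assms by (intro continuous_intros continuous_on_infdist) auto

lemma bump_periodic:
  "bump \<alpha> \<beta> d (x + 2 * pi * of_int k) = bump \<alpha> \<beta> d x"
proof -
  let ?S = "{x. \<forall>k::int. x + 2 * pi * k \<notin> {\<alpha><..<\<beta>}}"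
  have shift: "y + 2 * pi * of_int l \<in> ?S" if "y \<in> ?S" for y and l :: int
  proof -
    have "y + 2 * pi * of_int (l + k) \<notin> {\<alpha><..<\<beta>}" for k :: int using that by blast
    then show ?thesis by (simp add: algebra_simps)
  qed
  have le: "infdist (x + 2 * pi * of_int l) ?S \<le> infdist x ?S" for x and l :: int
  proof (cases "?S = {}")
    case False
    then show ?thesis
    proof (subst (2) infdist_def, simp only: if_False, intro cINF_greatest)
      fix y assume "y \<in> ?S"
      from infdist_le[OF shift[OF this], of "x + 2 * pi * of_int l" l]
      show "infdist (x + 2 * pi * of_int l) ?S \<le> dist x y" by (simp add: dist_real_def)
    qed
  qed (simp add: infdist_def)
  have "infdist x ?S = infdist ((x + 2 * pi * of_int k) + 2 * pi * of_int (- k)) ?S" by simp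
  also have "\<dots> \<le> infdist (x + 2 * pi * of_int k) ?S" by (rule le)
  finally show ?thesis using le[of x k] by (simp add: bump_def)
qed

lemma bump_eq_0:
  assumes "\<And>k::int. x + 2 * pi * k \<notin> {\<alpha><..<\<beta>}"
  shows "bump \<alpha> \<beta> d x = 0"
  using assms by (simp add: bump_def)

lemma bump_eq_1:
  assumes "0 < d" "\<beta> \<le> \<alpha> + 2 * pi" "\<alpha> + d \<le> x" "x \<le> \<beta> - d"
  shows "bump \<alpha> \<beta> d x = 1"
proof -
  let ?S = "{x. \<forall>k::int. x + 2 * pi * k \<notin> {\<alpha><..<\<beta>}}"
  have "\<alpha> + 2 * pi * k \<notin> {\<alpha><..<\<beta>}" for k :: int
  proof
    assume *: "\<alpha> + 2 * pi * k \<in> {\<alpha><..<\<beta>}"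
    then have "0 < 2 * pi * real_of_int k" by simp
    then have "1 \<le> real_of_int k" by (simp add: zero_less_mult_iff)
    then have "2 * pi \<le> 2 * pi * real_of_int k" by simp
    moreover have "\<alpha> + 2 * pi * real_of_int k < \<beta>" using * by simp
    ultimately show False using assms(2) by linarith
  qed
  then have ne: "\<alpha> \<in> ?S" by blast
  have "d \<le> infdist x ?S"
    unfolding infdist_def
  proof (subst if_not_P)
    show "?S \<noteq> {}" using ne by blast
    show "d \<le> (INF y\<in>?S. dist x y)"
    proof (rule cINF_greatest)
      show "?S \<noteq> {}" using ne by blast
      fix y assume "y \<in> ?S"
      then have "y + 2 * pi * of_int 0 \<notin> {\<alpha><..<\<beta>}" by blast
      then show "d \<le> dist x y" using assms by (auto simp: dist_real_def)
    qed
  qed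
  then show ?thesis using assms(1) by (simp add: bump_def)
qed

text \<open>
  If the functions have disjoint supports, then at most two of them are nonzero at \<open>x\<close> or at \<open>y\<close>, so the Lipschitz constant
  at most doubles, whatever the number of functions.
\<close>
lemma sum_disjoint_supports:
  fixes \<phi> :: "'i \<Rightarrow> real \<Rightarrow> real"
  assumes "finite I" "I \<noteq> {}" "0 \<le> L"
    and bd: "\<And>i x. i \<in> I \<Longrightarrow> \<bar>\<phi> i x\<bar> \<le> \<epsilon>"
    and lip: "\<And>i x y. i \<in> I \<Longrightarrow> \<bar>\<phi> i x - \<phi> i y\<bar> \<le> L * \<bar>x - y\<bar>"
    and disj: "\<And>i j x. \<lbrakk>i \<in> I; j \<in> I; \<phi> i x \<noteq> 0; \<phi> j x \<noteq> 0\<rbrakk> \<Longrightarrow> i = j"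
  shows "\<bar>\<Sum>i\<in>I. \<phi> i x\<bar> \<le> \<epsilon>" "\<bar>(\<Sum>i\<in>I. \<phi> i x) - (\<Sum>i\<in>I. \<phi> i y)\<bar> \<le> 2 * L * \<bar>x - y\<bar>"
proof -
  have single: "\<exists>i\<in>I. (\<Sum>i\<in>I. \<phi> i x) = \<phi> i x \<and> (\<forall>j\<in>I. j \<noteq> i \<longrightarrow> \<phi> j x = 0)" for x
  proof (cases "\<exists>i\<in>I. \<phi> i x \<noteq> 0")
    case True
    then obtain i where i: "i \<in> I" "\<phi> i x \<noteq> 0" by blast
    then have z: "\<forall>j\<in>I. j \<noteq> i \<longrightarrow> \<phi> j x = 0" using disj by blast
    then have "(\<Sum>i\<in>I. \<phi> i x) = \<phi> i x"
      using i assms(1) by (simp add: sum.remove)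
    then show ?thesis using i z by blast
  next
    case False
    then show ?thesis using assms(2) by auto
  qed
  show "\<bar>\<Sum>i\<in>I. \<phi> i x\<bar> \<le> \<epsilon>" using single[of x] bd by metis
  obtain i where i: "i \<in> I" "(\<Sum>i\<in>I. \<phi> i x) = \<phi> i x" "\<forall>j\<in>I. j \<noteq> i \<longrightarrow> \<phi> j x = 0"
    using single by blast
  obtain j where j: "j \<in> I" "(\<Sum>i\<in>I. \<phi> i y) = \<phi> j y" "\<forall>i\<in>I. i \<noteq> j \<longrightarrow> \<phi> i y = 0"
    using single by blast
  have "\<bar>\<phi> i x - \<phi> i y\<bar> \<le> L * \<bar>x - y\<bar>" "\<bar>\<phi> j x - \<phi> j y\<bar> \<le> L * \<bar>x - y\<bar>"
    using lip i j by auto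
  moreover have "0 \<le> L * \<bar>x - y\<bar>" using assms(3) by simp
  ultimately show "\<bar>(\<Sum>i\<in>I. \<phi> i x) - (\<Sum>i\<in>I. \<phi> i y)\<bar> \<le> 2 * L * \<bar>x - y\<bar>"
    using i j by (cases "i = j") auto
qed

section \<open>Unboundedness of the scaled coefficients\<close>

text \<open>
  The constants: the spacing of \<open>65\<close> cells leaves \<open>64\<close> whole cells, of total length \<open>pi / M\<close>, between the cells of a
  pair, which \<open>mean_chord_ge\<close> requires; leaving out the last \<open>64\<close> cells of the period
  ensures the same on the other side. The flanks of a bump cost at most
  \<open>M * 2 * pi / (64 * M) < 1/8\<close>, against a mean chord of at least \<open>1/2\<close>.
\<close>
lemma scaled_coeff_unbounded:
  fixes H :: "real \<Rightarrow> real"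
  assumes cont: "continuous_on UNIV H" and mono: "strict_mono H"
    and degree_1: "\<And>t. H (t + 2 * pi) = H t + 2 * pi"
  shows "\<exists>F\<in>hoelder_ball. \<exists>m. B \<le> cmod (scaled_coeff H m F)"
proof -
  \<comment> \<open>The bound \<open>260\<close> secures a block of \<open>2 * 65\<close> large cells and absorbs rounding in their division into blocks;
     \<open>3 / 8320\<close> is the product of all constants lost below.\<close>
  define B' where "B' = max 260 (8320/3 * B)"
  have B': "260 \<le> B'" "8320/3 * B \<le> B'" by (auto simp: B'_def)
  obtain J where J: "B'\<^sup>2 \<le> real J" using real_arch_simple by blast
  have "1 \<le> B'\<^sup>2" using B' by (intro one_le_power) simp
  then have J1: "1 \<le> real J" using J by linarith
  obtain \<rho> where \<rho>: "0 < \<rho>"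
    and uc: "\<And>x y. \<lbrakk>x \<in> {0..2*pi}; y \<in> {0..2*pi}; dist y x < \<rho>\<rbrakk> \<Longrightarrow> dist (H y) (H x) < 1 / J"
  proof -
    have "uniformly_continuous_on {0..2*pi} H"
      using cont by (intro compact_uniformly_continuous continuous_on_subset[OF cont]) auto
    moreover have "0 < 1 / real J" using J1 by simp
    ultimately show ?thesis using that unfolding uniformly_continuous_on_def by metis
  qed
  obtain M where M': "pi / \<rho> < real M" using reals_Archimedean2 by blast
  have "0 < pi / \<rho>" using \<rho> by simp
  then have "0 < real M" using M' by linarith
  then have M1: "1 \<le> M" and M: "pi / M < \<rho>" "1 \<le> real M"
    using M' \<rho> by (simp_all add: field_simps)
  \<comment> \<open>The grid consists of \<open>128 * M\<close> cells of the common length \<open>\<tau> 1 = pi / (64 * M)\<close>.\<close>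
  define \<tau> :: "nat \<Rightarrow> real" where "\<tau> = (\<lambda>p. p * (pi / (64 * M)))"
  have \<tau>_le: "\<tau> p \<le> \<tau> q" if "p \<le> q" for p q unfolding \<tau>_def using that by (intro mult_right_mono) auto
  have \<tau>_less: "\<tau> p < \<tau> (Suc p)" for p using M1 by (simp add: \<tau>_def field_simps)
  have \<tau>_0: "\<tau> 0 = 0" and \<tau>_N: "\<tau> (128 * M) = 2 * pi" and \<tau>_64: "\<tau> 64 = pi / M"
    and \<tau>_add: "\<And>p q. \<tau> (p + q) = \<tau> p + \<tau> q"
    and \<tau>_1: "\<tau> 1 = pi / (64 * M)"
    using M1 by (simp_all add: \<tau>_def field_simps)
  define N where "N = 128 * M - 64"
  have N: "N + 64 = 128 * M" using M1 by (simp add: N_def)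
  have \<tau>_in: "\<tau> p \<in> {0..2*pi}" if "p \<le> 128 * M" for p
    using \<tau>_le[of 0 p] \<tau>_le[OF that] \<tau>_0 \<tau>_N by simp
  have H_close: "H y - H x \<le> 1 / J" if "x \<in> {0..2*pi}" "y \<in> {0..2*pi}" "\<bar>y - x\<bar> \<le> pi / M" for x y
    using uc[of x y] that M(1) by (simp add: dist_real_def)
  define l where "l = (\<lambda>p. H (\<tau> (Suc p)) - H (\<tau> p))"
  have l: "0 \<le> l p" "p < N \<Longrightarrow> l p \<le> 1 / J" for p
  proof -
    show "0 \<le> l p" using strict_monoD[OF mono \<tau>_less[of p]] by (simp add: l_def)
    assume "p < N"
    moreover have "\<tau> (Suc p) - \<tau> p \<le> pi / M"
      using \<tau>_add[of p 1] \<tau>_le[of 1 64] \<tau>_64 by simp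
    moreover have "0 \<le> \<tau> (Suc p) - \<tau> p" using \<tau>_less[of p] by simp
    ultimately show "l p \<le> 1 / J"
      unfolding l_def using N by (intro H_close \<tau>_in) auto
  qed
  have sum_l: "2 * pi - 1 / J \<le> sum l {..<N}"
  proof -
    have "sum l {..<N} = H (\<tau> N) - H 0"
      unfolding l_def by (subst sum_lessThan_telescope) (simp add: \<tau>_0)
    moreover have "H (2 * pi) - H (\<tau> N) \<le> 1 / J"
    proof (rule H_close)
      have "\<tau> N + pi / M = 2 * pi" using \<tau>_add[of N 64] N \<tau>_64 \<tau>_N by simp
      then show "\<bar>2 * pi - \<tau> N\<bar> \<le> pi / M" using M(2) by (simp add: eq_diff_eq[symmetric])
      show "\<tau> N \<in> {0..2*pi}" using N by (intro \<tau>_in) simp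
    qed auto
    moreover have "H (2 * pi) = H 0 + 2 * pi" using degree_1[of 0] by simp
    ultimately show ?thesis by linarith
  qed
  \<comment> \<open>Otherwise the \<open>J\<close> largest increments, each at most \<open>1 / J\<close>, would add up to at most \<open>1\<close>, and so
     would the others together, whereas the sum is at least \<open>2 * pi - 1\<close>.\<close>
  have "\<exists>d>0. B' < card {p \<in> {..<N}. d \<le> l p} * sqrt d"
  proof (rule ccontr)
    assume *: "\<not> ?thesis"
    have "card {p \<in> {..<N}. d \<le> l p} * sqrt d \<le> B'" if "0 < d" for d
      using * that by (meson not_le)
    then have "sum l {..<N} \<le> real J * (1 / J) + B'\<^sup>2 / J"
      using J1 l by (intro sum_le_if_few_large) auto
    moreover have "B'\<^sup>2 / J \<le> 1" "real J * (1 / J) = 1" "1 / real J \<le> 1" using J J1 by auto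
    ultimately show False using sum_l pi_gt3 by linarith
  qed
  then obtain d where d: "0 < d" and card_d: "B' < card {p \<in> {..<N}. d \<le> l p} * sqrt d" by blast
  define P where "P = {p \<in> {..<N}. d \<le> l p}"
  have P: "finite P" by (simp add: P_def)
  have card_Pd: "B' < card P * sqrt d" unfolding P_def by (rule card_d)
  then have "P \<noteq> {}" using B'(1) by auto
  then have "d \<le> 1 / J" using l(2) by (force simp: P_def)
  also have "1 / real J \<le> 1" using J1 by simp
  finally have d1: "d \<le> 1" .
  have "real (card P) * sqrt d \<le> real (card P) * 1" using d1 by (intro mult_left_mono) auto
  then have card_P: "260 \<le> real (card P)" using card_Pd B'(1) by simp
  define n where "n = card P div 130"
  have n: "real (card P) \<le> 260 * real n" "n \<ge> 1"
  proof -
    have "260 \<le> card P" using card_P by simp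
    then have "260 div 130 \<le> n" unfolding n_def by (rule div_le_mono)
    moreover have "card P = n * 130 + card P mod 130" unfolding n_def by (rule div_mult_mod_eq[symmetric])
    moreover have "card P mod 130 < 130" by simp
    ultimately have "card P \<le> 260 * n" and n1: "n \<ge> 1" by linarith+
    then have "real (card P) \<le> real (260 * n)" by (simp only: of_nat_le_iff)
    then show "real (card P) \<le> 260 * real n" by simp
    show "n \<ge> 1" by (rule n1)
  qed
  have "\<exists>p q. \<forall>i < n. p i \<in> P \<and> q i \<in> P \<and> p i + 65 \<le> q i
      \<and> (\<forall>j < n. i < j \<longrightarrow> q i < p j)"
    using separated_pairs[OF P, of 65] by (simp add: n_def)
  then obtain p q where "\<forall>i < n. p i \<in> P \<and> q i \<in> P \<and> p i + 65 \<le> q i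
      \<and> (\<forall>j < n. i < j \<longrightarrow> q i < p j)" by (elim exE)
  then have pq: "p i \<in> P \<and> q i \<in> P \<and> p i + 65 \<le> q i \<and> (\<forall>j < n. i < j \<longrightarrow> q i < p j)"
    if "i < n" for i using that by simp
  define a b c e where "a = (\<lambda>i. \<tau> (p i))" and "b = (\<lambda>i. \<tau> (Suc (p i)))"
    and "c = (\<lambda>i. \<tau> (q i))" and "e = (\<lambda>i. \<tau> (Suc (q i)))"
  have pts: "0 \<le> a i" "a i \<le> b i" "b i \<le> c i" "c i \<le> e i" "e i \<le> 2 * pi"
      "b i - a i = pi / (64 * M)" "e i - c i = pi / (64 * M)"
      "pi / M \<le> c i - b i" "c i - b i \<le> 2 * pi - pi / M"
      "H (a i) + d \<le> H (b i)" "H (c i) + d \<le> H (e i)" if i: "i < n" for i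
  proof -
    have iN: "p i < N" "q i < N" "d \<le> l (p i)" "d \<le> l (q i)" "p i + 65 \<le> q i"
      using pq[OF i] by (auto simp: P_def)
    then show "0 \<le> a i" "a i \<le> b i" "b i \<le> c i" "c i \<le> e i"
      unfolding a_def b_def c_def e_def by (auto intro!: \<tau>_le simp flip: \<tau>_0)
    show "e i \<le> 2 * pi" unfolding e_def using iN N \<tau>_le[of "Suc (q i)" "128 * M"] \<tau>_N by simp
    show "b i - a i = pi / (64 * M)" "e i - c i = pi / (64 * M)"
      unfolding a_def b_def c_def e_def using \<tau>_add[of "p i" 1] \<tau>_add[of "q i" 1] \<tau>_1 by auto
    have "\<tau> (Suc (p i) + 64) \<le> \<tau> (q i)" using iN by (intro \<tau>_le) simp
    then show "pi / M \<le> c i - b i" unfolding b_def c_def \<tau>_add[of "Suc (p i)" 64] \<tau>_64 by simp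
    have "\<tau> (q i + 64) \<le> \<tau> (128 * M)" using iN N by (intro \<tau>_le) simp
    then show "c i - b i \<le> 2 * pi - pi / M"
      unfolding b_def c_def \<tau>_add[of "q i" 64] \<tau>_64 \<tau>_N using \<tau>_le[of 0 "Suc (p i)"] \<tau>_0 by simp
    show "H (a i) + d \<le> H (b i)" "H (c i) + d \<le> H (e i)"
      unfolding a_def b_def c_def e_def using iN by (auto simp: l_def)
  qed
  have e_le_a: "e i \<le> a j" if "i < j" "j < n" for i j
    unfolding e_def a_def using pq[of i] that by (intro \<tau>_le) auto
  have H_le: "H x \<le> H y \<longleftrightarrow> x \<le> y" and H_less: "H x < H y \<longleftrightarrow> x < y" for x y
    using mono by (simp_all add: strict_mono_less_eq strict_mono_less)
  have H_2pi: "H (2 * pi) = H 0 + 2 * pi" using degree_1[of 0] by simp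
  define \<phi> where "\<phi> = (\<lambda>i. bump (H (a i)) (H (e i)) d)"
  \<comment> \<open>Within one period, \<open>\<phi> i\<close> is carried by the interval between the outer ends of its two cells.\<close>
  have \<phi>_supp: "\<exists>k::int. x + 2 * pi * k \<in> {H (a i)<..<H (e i)}" if "\<phi> i x \<noteq> 0" for i x
    using that bump_eq_0[of x "H (a i)" "H (e i)" d] by (fastforce simp: \<phi>_def)
  have within: "H 0 \<le> H (a i)" "H (e i) \<le> H 0 + 2 * pi" if "i < n" for i
    using pts[OF that] by (simp_all add: H_le flip: H_2pi)
  have unique_shift: "k = k'" if "x + 2 * pi * of_int k \<in> {H 0..<H 0 + 2 * pi}"
    "x + 2 * pi * of_int k' \<in> {H 0..<H 0 + 2 * pi}" for x and k k' :: int
  proof -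
    have "\<bar>2 * pi * (real_of_int k - real_of_int k')\<bar> < 2 * pi * 1"
      using that by (auto simp: algebra_simps abs_less_iff)
    then have "\<bar>real_of_int k - real_of_int k'\<bar> < 1" by (simp add: abs_mult)
    then have "real_of_int \<bar>k - k'\<bar> < real_of_int 1" by simp
    then show ?thesis unfolding of_int_less_iff by linarith
  qed
  have \<phi>_disj: "i = j" if ij: "i \<in> {..<n}" "j \<in> {..<n}" "\<phi> i x \<noteq> 0" "\<phi> j x \<noteq> 0" for i j x
  proof (rule ccontr)
    assume "i \<noteq> j"
    obtain k k' :: int where k: "x + 2 * pi * k \<in> {H (a i)<..<H (e i)}"
      "x + 2 * pi * k' \<in> {H (a j)<..<H (e j)}"
      using \<phi>_supp ij(3,4) by blast
    have "k = k'" using k within[of i] within[of j] ij(1,2) by (intro unique_shift[of x]) auto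
    moreover have "H (e i) \<le> H (a j) \<or> H (e j) \<le> H (a i)"
      using e_le_a[of i j] e_le_a[of j i] \<open>i \<noteq> j\<close> ij(1,2) by (auto simp: H_le neq_iff)
    ultimately show False using k by auto
  qed
  have \<phi>_H_0: "\<phi> i (H t) = 0" if i: "i < n" and t: "t \<in> {0..2*pi}" "t \<notin> {a i<..<e i}" for i t
  proof (cases "t = 2 * pi")
    case True
    have "\<phi> i (H (2 * pi)) = \<phi> i (H 0)"
      unfolding H_2pi \<phi>_def using bump_periodic[of _ _ _ "H 0" 1] by simp
    moreover have "\<phi> i (H 0) = 0"
    proof (rule ccontr)
      assume "\<phi> i (H 0) \<noteq> 0"
      then obtain k :: int where k: "H 0 + 2 * pi * k \<in> {H (a i)<..<H (e i)}" using \<phi>_supp by blast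
      then have "H 0 + 2 * pi * k \<in> {H 0..<H 0 + 2 * pi}"
        using within[OF i] unfolding atLeastLessThan_iff greaterThanLessThan_iff by linarith
      then have "k = 0" by (rule unique_shift) simp
      then show False using k within[OF i] by simp
    qed
    ultimately show ?thesis using True by simp
  next
    case False
    show ?thesis
    proof (rule ccontr)
      assume "\<phi> i (H t) \<noteq> 0"
      then obtain k :: int where k: "H t + 2 * pi * k \<in> {H (a i)<..<H (e i)}" using \<phi>_supp by blast
      have "H 0 \<le> H t" "H t < H (2 * pi)" using t(1) False by (auto simp: H_le H_less)
      then have "k = 0" using k within[OF i] H_2pi by (intro unique_shift[of "H t"]) auto
      then show False using k t(2) by (auto simp: H_less)
    qed
  qed
  have \<phi>_H_1: "\<phi> i (H t) = 1" if i: "i < n" and t: "t \<in> {b i..c i}" for i t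
    unfolding \<phi>_def
  proof (rule bump_eq_1[OF d])
    show "H (e i) \<le> H (a i) + 2 * pi" using within[OF i] by linarith
    have "H (b i) \<le> H t" "H t \<le> H (c i)" using t by (auto simp: H_le)
    then show "H (a i) + d \<le> H t" "H t \<le> H (e i) - d" using pts[OF i] by linarith+
  qed
  \<comment> \<open>Averaging over the frequencies \<open>1, \<dots>, M\<close> yields one that suits all pairs on average.\<close>
  obtain m where m: "m \<in> {1..M}" and chords: "real n / 2 \<le> (\<Sum>i<n. cmod (cis (m * (c i - b i)) - 1))"
  proof -
    have "\<exists>m\<in>{1..M}. real n / 2 \<le> (\<Sum>i<n. cmod (cis (m * (c i - b i)) - 1))"
    proof (rule ccontr)
      assume "\<not> ?thesis"
      then have "(\<Sum>m=1..M. \<Sum>i<n. cmod (cis (m * (c i - b i)) - 1)) < (\<Sum>m=1..M. real n / 2)"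
        using M1 by (intro sum_strict_mono) (auto simp: not_le)
      also have "(\<Sum>m=1..M. real n / 2) = (\<Sum>i<n. real M / 2)" by simp
      also have "\<dots> \<le> (\<Sum>i<n. \<Sum>m=1..M. cmod (cis (m * (c i - b i)) - 1))"
        using pts by (intro sum_mono mean_chord_ge M1) auto
      also have "\<dots> = (\<Sum>m=1..M. \<Sum>i<n. cmod (cis (m * (c i - b i)) - 1))" by (rule sum.swap)
      finally show False by simp
    qed
    then show ?thesis using that by blast
  qed
  define w where "w = (\<lambda>i. scaled_coeff H m (\<phi> i))"
  have w: "cmod (cis (m * (c i - b i)) - 1) - 1/8 \<le> cmod (w i)" if i: "i < n" for i
  proof -
    let ?E = "\<lambda>t. cis (- (real m * t))"
    let ?X = "integral {0..2*pi} (\<lambda>t. of_real (\<phi> i (H t)) * ?E t)"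
    let ?Y = "integral {b i..c i} ?E"
    have "continuous_on {0..2*pi} (\<lambda>t. \<phi> i (H t))"
      unfolding \<phi>_def by (rule continuous_on_compose2[OF bump_continuous[OF d, of UNIV]])
        (use continuous_on_subset[OF cont] in auto)
    then have "cmod (?X - ?Y) \<le> (b i - a i) + (e i - c i)"
      using pts[OF i] \<phi>_H_0[OF i] \<phi>_H_1[OF i] bump_bounds[OF d]
      by (intro norm_integral_plateau_le continuous_on_cis_mult) (auto simp: \<phi>_def)
    also have "\<dots> = pi / (32 * M)" using pts[OF i] by simp
    finally have "real m * cmod (?X - ?Y) \<le> real M * (pi / (32 * M))"
      using m by (intro mult_mono) auto
    also have "\<dots> \<le> 1/8" using M1 pi_less_4 by simp
    finally have err: "cmod (of_nat m * (?X - ?Y)) \<le> 1/8" by (simp add: norm_mult)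
    have "cmod (of_nat m * ?Y) = cmod (cis (m * (c i - b i)) - 1)"
      using norm_integral_cis[OF pts(3)[OF i], of m] by (simp add: norm_mult)
    moreover have "cmod (of_nat m * ?Y) \<le> cmod (of_nat m * ?X) + cmod (of_nat m * (?X - ?Y))"
      using norm_triangle_ineq4[of "of_nat m * ?X" "of_nat m * (?X - ?Y)"] by (simp add: algebra_simps)
    ultimately show ?thesis using err by (simp add: w_def scaled_coeff_def)
  qed
  have "real n / 2 - real n / 8 \<le> (\<Sum>i<n. cmod (cis (m * (c i - b i)) - 1) - 1/8)"
    using chords by (simp add: sum_subtractf)
  also have "\<dots> \<le> (\<Sum>i<n. cmod (w i))" using w by (intro sum_mono) auto
  finally have sum_w: "3/8 * real n \<le> (\<Sum>i<n. cmod (w i))" by simp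
  obtain s :: "nat \<Rightarrow> real" where s: "\<And>i. \<bar>s i\<bar> = 1"
    and sum_sw: "(\<Sum>i<n. cmod (w i)) / 2 \<le> cmod (\<Sum>i<n. of_real (s i) * w i)"
    using signs_capture_half_of_norm_sum[where I = "{..<n}" and w = w] by blast
  define F where "F = (\<lambda>x. \<Sum>i<n. (sqrt d / 2 * s i) * \<phi> i x)"
  have F_bounds: "\<bar>F x\<bar> \<le> sqrt d / 2" "\<bar>F x - F y\<bar> \<le> 2 * (sqrt d / 2 / d) * \<bar>x - y\<bar>" for x y
  proof -
    have "0 \<in> {..<n}" using n(2) by simp
    then have 1: "finite {..<n}" "{..<n} \<noteq> {}" "0 \<le> sqrt d / 2 / d" using d by auto
    have 2: "\<bar>sqrt d / 2 * s i * \<phi> i x\<bar> \<le> sqrt d / 2" for i x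
      using bump_bounds[OF d, of "H (a i)" "H (e i)" x] s[of i] d
      by (simp add: abs_mult \<phi>_def mult_left_le)
    have 3: "\<bar>sqrt d / 2 * s i * \<phi> i x - sqrt d / 2 * s i * \<phi> i y\<bar> \<le> sqrt d / 2 / d * \<bar>x - y\<bar>" for i x y
    proof -
      have "sqrt d / 2 * s i * \<phi> i x - sqrt d / 2 * s i * \<phi> i y = sqrt d / 2 * s i * (\<phi> i x - \<phi> i y)"
        by (rule right_diff_distrib[symmetric])
      also have "\<bar>\<dots>\<bar> = sqrt d / 2 * \<bar>\<phi> i x - \<phi> i y\<bar>"
        using s[of i] d by (simp add: abs_mult)
      also have "\<dots> \<le> sqrt d / 2 * (\<bar>x - y\<bar> / d)"
        unfolding \<phi>_def using d by (intro mult_left_mono bump_lipschitz) auto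
      finally show ?thesis by simp
    qed
    have 4: "i = j" if "i \<in> {..<n}" "j \<in> {..<n}" "sqrt d / 2 * s i * \<phi> i x \<noteq> 0"
      "sqrt d / 2 * s j * \<phi> j x \<noteq> 0" for i j x
      using that by (intro \<phi>_disj[of i j x]) auto
    show "\<bar>F x\<bar> \<le> sqrt d / 2" "\<bar>F x - F y\<bar> \<le> 2 * (sqrt d / 2 / d) * \<bar>x - y\<bar>"
      unfolding F_def
      by (rule sum_disjoint_supports[where \<phi> = "\<lambda>i x. sqrt d / 2 * s i * \<phi> i x", OF 1 2 3 4]; assumption)+
  qed
  have "F \<in> hoelder_ball"
    unfolding hoelder_ball_def
  proof (intro CollectI conjI allI)
    fix x y :: real and k :: int
    have "sqrt d \<le> 1" using d1 by simp
    then show "\<bar>F x\<bar> \<le> 1" using F_bounds(1)[of x] by linarith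
    show "F (x + 2 * pi * k) = F x" by (simp add: F_def \<phi>_def bump_periodic)
    show "\<bar>F x - F y\<bar> \<le> sqrt \<bar>x - y\<bar>"
    proof (cases "\<bar>x - y\<bar> \<le> d")
      case True
      have "\<bar>F x - F y\<bar> \<le> sqrt d / d * \<bar>x - y\<bar>" using F_bounds(2)[of x y] by simp
      also have "\<dots> = sqrt \<bar>x - y\<bar> * (sqrt \<bar>x - y\<bar> / sqrt d)"
        using d by (simp add: field_simps)
      also have "\<dots> \<le> sqrt \<bar>x - y\<bar> * 1" using True d by (intro mult_left_mono) auto
      finally show ?thesis by simp
    next
      case False
      have "\<bar>F x - F y\<bar> \<le> sqrt d" using F_bounds(1)[of x] F_bounds(1)[of y] by linarith
      also have "\<dots> \<le> sqrt \<bar>x - y\<bar>" using False by simp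
      finally show ?thesis .
    qed
  qed
  moreover have "B \<le> cmod (scaled_coeff H m F)"
  proof -
    have "scaled_coeff H m F = (\<Sum>i<n. of_real (sqrt d / 2 * s i) * w i)"
      unfolding F_def w_def by (rule scaled_coeff_sum[OF cont]) (auto simp: \<phi>_def intro: bump_continuous d)
    also have "\<dots> = of_real (sqrt d / 2) * (\<Sum>i<n. of_real (s i) * w i)"
      by (simp add: sum_distrib_left mult.assoc)
    also have "cmod \<dots> = sqrt d / 2 * cmod (\<Sum>i<n. of_real (s i) * w i)"
      unfolding norm_mult norm_of_real using d by simp
    finally have "cmod (scaled_coeff H m F) = sqrt d / 2 * cmod (\<Sum>i<n. of_real (s i) * w i)" .
    moreover have "sqrt d / 2 * (3/16 * real n) \<le> sqrt d / 2 * cmod (\<Sum>i<n. of_real (s i) * w i)"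
      using sum_sw sum_w d by (intro mult_left_mono) auto
    moreover have "sqrt d / 2 * (3/16 * (real (card P) / 260)) \<le> sqrt d / 2 * (3/16 * real n)"
      using n(1) d by (intro mult_left_mono) auto
    moreover have "sqrt d / 2 * (3/16 * (real (card P) / 260)) = 3 / 8320 * (real (card P) * sqrt d)"
      by simp
    ultimately show ?thesis using card_Pd B'(2) by linarith
  qed
  ultimately show ?thesis by blast
qed

section \<open>Lifting homeomorphisms of the circle\<close>

text \<open>
  The embedding of the circle into the complex plane, which gives access to continuous logarithms.
\<close>
definition circle_exp :: "circle \<Rightarrow> complex" where
  "circle_exp z = cis (rep_circle z)"

lemma abs_circle_eq_iff: "abs_circle s = abs_circle t \<longleftrightarrow> (\<exists>k::int. s = t + 2 * pi * k)"
  by (auto simp: circle.abs_eq_iff circle_rel_def algebra_simps)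

lemma abs_circle_rep: "abs_circle (rep_circle z) = z"
  by (rule Quotient3_abs_rep[OF Quotient3_circle])

lemma cis_eq_iff: "cis s = cis t \<longleftrightarrow> abs_circle s = abs_circle t"
proof -
  have "cis s = cis t \<longleftrightarrow> exp (\<i> * of_real s) = exp (\<i> * of_real t)" by (simp add: cis_conv_exp)
  also have "\<dots> \<longleftrightarrow> (\<exists>k::int. s = t + 2 * pi * k)"
    unfolding exp_eq by (auto simp: complex_eq_iff algebra_simps)
  finally show ?thesis by (simp add: abs_circle_eq_iff)
qed

lemma circle_exp_abs: "circle_exp (abs_circle t) = cis t"
  unfolding circle_exp_def cis_eq_iff by (rule abs_circle_rep)

lemma continuous_on_abs_circle: "continuous_on UNIV abs_circle"
  by (simp add: continuous_on_open_vimage open_circle_def)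

lemma continuous_on_circle_exp: "continuous_on UNIV circle_exp"
proof -
  have "open (circle_exp -` U)" if "open U" for U
  proof -
    have "abs_circle -` circle_exp -` U = cis -` U" by (auto simp: circle_exp_abs)
    moreover have "continuous_on UNIV cis" unfolding cis_conv_exp by (intro continuous_intros)
    ultimately show ?thesis using that by (simp add: open_circle_def continuous_on_open_vimage)
  qed
  then show ?thesis by (simp add: continuous_on_open_vimage)
qed

text \<open>
  A continuous logarithm of the nonvanishing function \<open>t \<mapsto> circle_exp (h (abs_circle t))\<close> on the contractible line
  is purely imaginary, and its imaginary part is the lift.
\<close>
lemma lift_to_line:
  assumes "continuous_on UNIV h"
  obtains H :: "real \<Rightarrow> real" where "continuous_on UNIV H" "\<And>t. abs_circle (H t) = h (abs_circle t)"
proof -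
  define E where "E = (\<lambda>t. circle_exp (h (abs_circle t)))"
  have "continuous_on UNIV E"
    unfolding E_def
    by (rule continuous_on_compose2[OF continuous_on_circle_exp
          continuous_on_compose2[OF assms continuous_on_abs_circle]]) auto
  moreover have "cmod (E t) = 1" for t by (simp add: E_def circle_exp_def)
  then have "E t \<noteq> 0" for t by (metis norm_zero zero_neq_one)
  ultimately obtain g where g: "continuous_on UNIV g" "\<And>t. E t = exp (g t)"
    using continuous_logarithm_on_contractible[of UNIV E] by (metis UNIV_I contractible_UNIV)
  have "exp (Re (g t)) = 1" for t
    using \<open>\<And>t. cmod (E t) = 1\<close>[of t] g(2)[of t] by (simp add: norm_exp_eq_Re)
  then have "E t = cis (Im (g t))" for t
    using g(2)[of t] exp_eq_polar[of "g t"] by simp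
  moreover have "E t = cis (rep_circle (h (abs_circle t)))" for t
    by (simp add: E_def circle_exp_def)
  ultimately have "abs_circle (Im (g t)) = h (abs_circle t)" for t
    by (metis cis_eq_iff abs_circle_rep)
  moreover have "continuous_on UNIV (\<lambda>t. Im (g t))" using g(1) by (intro continuous_intros)
  ultimately show ?thesis using that by blast
qed

text \<open>
  The number of turns that \<open>H\<close> makes over a period starting at \<open>t\<close> is an integer depending continuously on \<open>t\<close>.
\<close>
lemma lift_translation:
  fixes H :: "real \<Rightarrow> real"
  assumes cont: "continuous_on UNIV H" and lift: "\<And>t. abs_circle (H t) = h (abs_circle t)"
  obtains n :: int where "\<And>t. H (t + 2 * pi) = H t + 2 * pi * n"
proof -
  define D where "D = (\<lambda>t. (H (t + 2 * pi) - H t) / (2 * pi))"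
  have "D t \<in> \<int>" for t
  proof -
    have "abs_circle (t + 2 * pi) = abs_circle t"
      unfolding abs_circle_eq_iff by (rule exI[of _ 1]) simp
    then have "abs_circle (H (t + 2 * pi)) = abs_circle (H t)" by (simp add: lift)
    then obtain k :: int where "H (t + 2 * pi) = H t + 2 * pi * k" unfolding abs_circle_eq_iff by blast
    then have "D t = of_int k" by (simp add: D_def)
    then show ?thesis by simp
  qed
  moreover have "continuous_on UNIV D"
    unfolding D_def
    by (intro continuous_intros continuous_on_compose2[OF cont] cont) auto
  ultimately have "D constant_on UNIV"
    by (intro continuous_discrete_range_constant connected_UNIV)
       (use \<open>\<And>t. D t \<in> \<int>\<close> in \<open>auto intro!: exI[of _ 1] Ints_nonzero_abs_ge1 Ints_diff\<close>)
  then obtain y where y: "\<And>t. D t = y" by (auto simp: constant_on_def)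
  with \<open>D 0 \<in> \<int>\<close> obtain n :: int where "y = of_int n" by (auto elim: Ints_cases)
  then have "H (t + 2 * pi) = H t + 2 * pi * n" for t
    using y[of t] by (simp add: D_def field_simps)
  then show ?thesis using that by blast
qed

text \<open>
  The degree \<open>n\<close> of an injective circle map is \<open>\<plusminus> 1\<close>: by the intermediate value theorem, for \<open>n = 0\<close> the lift would
  take some value twice within a period, and for \<open>\<bar>n\<bar> \<ge> 2\<close> it would reach \<open>H 0 \<plusminus> 2 * pi\<close> before the
  period is over. Then \<open>H\<close> is injective on the whole line, hence monotone, and multiplication by
  \<open>\<sigma> = n\<close> makes it increasing.
\<close>
lemma homeomorphism_lift:
  assumes hom: "homeomorphism UNIV UNIV h h'"
  shows "\<exists>\<sigma>::real. \<exists>H :: real \<Rightarrow> real. (\<sigma> = 1 \<or> \<sigma> = - 1) \<and> continuous_on UNIV H \<and> strict_mono H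
    \<and> (\<forall>t. H (t + 2 * pi) = H t + 2 * pi) \<and> (\<forall>t. h (abs_circle t) = abs_circle (\<sigma> * H t))"
proof -
  have inj: "inj h" using hom by (metis homeomorphism_apply1 injI UNIV_I)
  obtain H where H: "continuous_on UNIV H" and lift: "\<And>t. abs_circle (H t) = h (abs_circle t)"
    using lift_to_line homeomorphism_cont1[OF hom] by blast
  obtain n :: int where n: "\<And>t. H (t + 2 * pi) = H t + 2 * pi * n"
    using lift_translation[OF H lift] by blast
  have fibre: "\<exists>k::int. s = t + 2 * pi * k" if "H s = H t + 2 * pi * of_int l" for s t and l :: int
  proof -
    have "abs_circle (H s) = abs_circle (H t)" unfolding abs_circle_eq_iff using that by blast
    then have "h (abs_circle s) = h (abs_circle t)" by (simp only: lift)
    then show ?thesis using inj by (simp add: inj_eq abs_circle_eq_iff)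
  qed
  have close: "s = t" if eq: "H s = H t + 2 * pi * of_int l" and lt: "\<bar>s - t\<bar> < 2 * pi" for s t and l :: int
  proof -
    obtain k :: int where k: "s = t + 2 * pi * k" using fibre[OF eq] by blast
    then have "\<bar>real_of_int k\<bar> < 1" using lt by (simp add: abs_mult)
    then show ?thesis using k by (simp flip: of_int_abs)
  qed
  have H_shift: "H (t + 2 * pi * of_int k) = H t + 2 * pi * of_int n * of_int k" for t and k :: int
  proof (induction k rule: int_induct[of _ 0])
    case (step1 k)
    have "t + 2 * pi * of_int (k + 1) = (t + 2 * pi * of_int k) + 2 * pi" by (simp add: algebra_simps)
    then have "H (t + 2 * pi * of_int (k + 1)) = H (t + 2 * pi * of_int k) + 2 * pi * n"
      by (simp only: n)
    also have "\<dots> = H t + 2 * pi * of_int n * of_int k + 2 * pi * n"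
      by (simp only: step1)
    also have "\<dots> = H t + 2 * pi * of_int n * of_int (k + 1)" by (simp add: algebra_simps)
    finally show ?case .
  next
    case (step2 k)
    have "t + 2 * pi * of_int k = (t + 2 * pi * of_int (k - 1)) + 2 * pi" by (simp add: algebra_simps)
    then show ?case using step2 n[of "t + 2 * pi * of_int (k - 1)"] by (simp add: algebra_simps)
  qed simp
  have inj_half: "inj_on H {0..<2*pi}"
  proof (rule inj_onI)
    fix s t assume "s \<in> {0..<2*pi}" "t \<in> {0..<2*pi}" "H s = H t"
    then show "s = t" using close[of s t 0] by auto
  qed
  have attained: "\<exists>s. 0 \<le> s \<and> s \<le> 2 * pi \<and> H s = v"
    if "min (H 0) (H (2*pi)) \<le> v" "v \<le> max (H 0) (H (2*pi))" for v
    using that IVT'[of H 0 v "2*pi"] IVT2'[of H "2*pi" v 0] continuous_on_subset[OF H]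
    by (cases "H 0 \<le> H (2*pi)") auto
  have n_abs: "\<bar>n\<bar> = 1"
  proof (rule ccontr)
    assume "\<bar>n\<bar> \<noteq> 1"
    then consider "n = 0" | "\<bar>n\<bar> \<ge> 2" by linarith
    then show False
    proof cases
      case 1
      then have eq: "H (2 * pi) = H 0" using n[of 0] by simp
      define v where "v = (H 0 + H pi) / 2"
      have ne: "H pi \<noteq> H 0" using close[of pi 0 0] by auto
      have "\<exists>s. 0 \<le> s \<and> s \<le> pi \<and> H s = v"
        using IVT'[of H 0 v pi] IVT2'[of H pi v 0] continuous_on_subset[OF H] ne
        by (cases "H 0 \<le> H pi") (auto simp: v_def)
      then obtain s where s: "0 \<le> s" "s \<le> pi" "H s = v" by blast
      have "\<exists>t. pi \<le> t \<and> t \<le> 2 * pi \<and> H t = v"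
        using IVT'[of H pi v "2*pi"] IVT2'[of H "2*pi" v pi] continuous_on_subset[OF H] ne eq
        by (cases "H 0 \<le> H pi") (auto simp: v_def)
      then obtain t where t: "pi \<le> t" "t \<le> 2 * pi" "H t = v" by blast
      have vn: "v \<noteq> H 0" "v \<noteq> H pi" using ne by (auto simp: v_def)
      have "s \<noteq> 0" "s \<noteq> pi" "t \<noteq> pi" using vn s(3) t(3) by auto
      then have "\<bar>s - t\<bar> < 2 * pi" "s < t" using s t by auto
      then show False using close[of s t 0] s(3) t(3) by simp
    next
      case 2
      define l :: int where "l = sgn n"
      have "\<exists>s. 0 \<le> s \<and> s \<le> 2 * pi \<and> H s = H 0 + 2 * pi * l"
      proof (rule attained)
        have eq: "H (2 * pi) = H 0 + 2 * pi * n" using n[of 0] by simp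
        have "0 \<le> l \<and> l \<le> n \<or> n \<le> l \<and> l \<le> 0" using 2 by (auto simp: l_def sgn_if)
        then show "min (H 0) (H (2*pi)) \<le> H 0 + 2 * pi * l" "H 0 + 2 * pi * l \<le> max (H 0) (H (2*pi))"
          unfolding eq by (auto simp: min_le_iff_disj le_max_iff_disj zero_le_mult_iff mult_le_0_iff)
      qed
      then obtain s where s: "0 \<le> s" "s \<le> 2 * pi" "H s = H 0 + 2 * pi * l" by blast
      have "l \<noteq> 0" "l \<noteq> n" using 2 by (auto simp: l_def sgn_if)
      have "s \<noteq> 2 * pi" using s(3) n[of 0] \<open>l \<noteq> n\<close> by auto
      then have "s = 0" using close[of s 0 l] s by auto
      then show False using s(3) \<open>l \<noteq> 0\<close> by simp
    qed
  qed
  have "inj H"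
  proof (rule injI)
    fix s t assume eq: "H s = H t"
    then obtain k :: int where k: "s = t + 2 * pi * k" using fibre[of s t 0] by auto
    then have "2 * pi * real_of_int n * of_int k = 0" using H_shift[of t k] eq by simp
    then have "k = 0" using n_abs by auto
    then show "s = t" using k by simp
  qed
  then have mono: "strict_mono_on UNIV H \<or> strict_antimono_on UNIV H"
    using injective_eq_monotone_map[of UNIV H] H by auto
  define \<sigma> where "\<sigma> = real_of_int n"
  have \<sigma>: "\<sigma> = 1 \<or> \<sigma> = - 1" using n_abs by (auto simp: \<sigma>_def abs_if split: if_splits)
  have step: "H (2 * pi) = H 0 + 2 * pi * \<sigma>" using n[of 0] by (simp add: \<sigma>_def)
  have "strict_mono (\<lambda>t. \<sigma> * H t)"
    using \<sigma>
  proof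
    assume 1: "\<sigma> = 1"
    have "\<not> strict_antimono_on UNIV H"
    proof
      assume "strict_antimono_on UNIV H"
      then have "H (2 * pi) < H 0" by (rule monotone_onD) auto
      then show False using step 1 by simp
    qed
    then show ?thesis using mono 1 by simp
  next
    assume 1: "\<sigma> = -1"
    have "\<not> strict_mono_on UNIV H"
    proof
      assume "strict_mono_on UNIV H"
      then have "H 0 < H (2 * pi)" by (rule strict_mono_onD) auto
      then show False using step 1 by simp
    qed
    then have "strict_antimono_on UNIV H" using mono by simp
    then show ?thesis using 1 by (auto simp: monotone_on_def strict_mono_def)
  qed
  moreover have "\<sigma> * H (t + 2 * pi) = \<sigma> * H t + 2 * pi" for t
    using n[of t] \<sigma> by (auto simp flip: \<sigma>_def)
  moreover have "continuous_on UNIV (\<lambda>t. \<sigma> * H t)" using H by (intro continuous_intros)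
  moreover have "h (abs_circle t) = abs_circle (\<sigma> * (\<sigma> * H t))" for t
    using \<sigma> by (auto simp: lift)
  ultimately show ?thesis
    using \<sigma> by (intro exI[of _ \<sigma>] exI[of _ "\<lambda>t. \<sigma> * H t"]) blast
qed

section \<open>The theorem\<close>

theorem theorem2:
  "\<exists>\<omega> :: real \<Rightarrow> real.
     strict_mono_on {0..} \<omega> \<and> continuous_on {0..} \<omega> \<and> \<omega> 0 = 0 \<and>
     (\<forall>h h' :: circle \<Rightarrow> circle. homeomorphism UNIV UNIV h h' \<longrightarrow>
        (\<exists>f \<in> H_class \<omega>.
           \<not> (\<lambda>k::int. cmod (fourier_coeff (\<lambda>t. complex_of_real ((f \<circ> h) t)) k))
               \<in> o[filtercomap abs at_top](\<lambda>k. 1 / \<bar>real_of_int k\<bar>)))"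
proof (rule exI[of _ sqrt], intro conjI allI impI)
  show "strict_mono_on {0..} sqrt" by (auto intro: strict_mono_onI)
  show "continuous_on {0..} sqrt" by (intro continuous_intros)
  show "sqrt 0 = 0" by simp
  fix h h' :: "circle \<Rightarrow> circle"
  assume "homeomorphism UNIV UNIV h h'"
  from homeomorphism_lift[OF this] obtain \<sigma> :: real and H where \<sigma>: "\<sigma> = 1 \<or> \<sigma> = - 1"
    and H: "continuous_on UNIV H" "strict_mono H" and degree_1: "\<forall>t. H (t + 2 * pi) = H t + 2 * pi"
    and lift: "\<forall>t. h (abs_circle t) = abs_circle (\<sigma> * H t)"
    by (elim exE conjE)
  have "\<exists>F\<in>hoelder_ball. \<forall>B. \<exists>m. B < cmod (scaled_coeff H m F)"
  proof (rule condensation_of_singularities)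
    fix c :: "nat \<Rightarrow> real" and f :: "nat \<Rightarrow> real \<Rightarrow> real"
    assume "\<And>n. f n \<in> hoelder_ball" "summable (\<lambda>n. \<bar>c n\<bar>)" "(\<Sum>n. \<bar>c n\<bar>) \<le> 1"
    then show "(\<forall>x. summable (\<lambda>n. c n * f n x)) \<and> (\<lambda>x. \<Sum>n. c n * f n x) \<in> hoelder_ball"
      by (rule hoelder_ball_series)
  next
    fix m f g and a b :: real
    assume fg: "f \<in> hoelder_ball" "g \<in> hoelder_ball"
    have "continuous_on UNIV (if i then f else g)" for i :: bool
      using fg hoelder_ball_continuous by simp
    from scaled_coeff_sum[where I = UNIV and \<phi> = "\<lambda>i. if i then f else g"
        and s = "\<lambda>i. if i then a else b" and m = m, OF H(1) this finite]
    show "scaled_coeff H m (\<lambda>x. a * f x + b * g x)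
        = of_real a * scaled_coeff H m f + of_real b * scaled_coeff H m g"
      by (simp add: UNIV_bool add.commute)
  next
    show "bdd_above ((\<lambda>F. cmod (scaled_coeff H m F)) ` hoelder_ball)" for m
      by (rule bdd_aboveI2) (rule norm_scaled_coeff_le[OF H(1)])
  next
    show "\<exists>F\<in>hoelder_ball. \<exists>m. B \<le> cmod (scaled_coeff H m F)" for B
      by (rule scaled_coeff_unbounded[OF H spec[OF degree_1]])
  qed
  then obtain F where F: "F \<in> hoelder_ball" and F_unbounded: "\<And>B. \<exists>m. B < cmod (scaled_coeff H m F)"
    by blast
  define f where "f = (\<lambda>z. F (\<sigma> * rep_circle z))"
  have f_abs: "f (abs_circle x) = F (\<sigma> * x)" for x
  proof -
    have "abs_circle (rep_circle (abs_circle x)) = abs_circle x" by (rule abs_circle_rep)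
    then obtain k :: int where "rep_circle (abs_circle x) = x + 2 * pi * k"
      unfolding abs_circle_eq_iff by blast
    moreover have "\<exists>l::int. \<sigma> * (2 * pi * k) = 2 * pi * l"
      using \<sigma>
    proof
      assume "\<sigma> = - 1"
      then show ?thesis by (intro exI[of _ "- k"]) simp
    qed auto
    then obtain l :: int where "\<sigma> * (2 * pi * k) = 2 * pi * l" by blast
    ultimately have "\<sigma> * rep_circle (abs_circle x) = \<sigma> * x + 2 * pi * of_int l"
      by (simp only: distrib_left)
    then show ?thesis unfolding f_def by (simp only: hoelder_ballD(3)[OF F])
  qed
  have "f \<in> H_class sqrt"
  proof -
    have "modulus_of_continuity \<delta> f \<le> ereal (1 * sqrt \<delta>)" for \<delta>
      unfolding modulus_of_continuity_def
    proof (rule SUP_least, clarify)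
      fix s t :: real assume st: "\<bar>s - t\<bar> < \<delta>"
      have "\<bar>f (abs_circle s) - f (abs_circle t)\<bar> \<le> sqrt \<bar>\<sigma> * s - \<sigma> * t\<bar>"
        unfolding f_abs by (rule hoelder_ballD(2)[OF F])
      also have "\<bar>\<sigma> * s - \<sigma> * t\<bar> = \<bar>s - t\<bar>" using \<sigma> by auto
      also have "sqrt \<bar>s - t\<bar> \<le> sqrt \<delta>" using st by simp
      finally show "ereal \<bar>f (abs_circle s) - f (abs_circle t)\<bar> \<le> ereal (1 * sqrt \<delta>)" by simp
    qed
    then show ?thesis unfolding H_class_def by (intro CollectI exI[of _ 1] always_eventually allI)
  qed
  moreover have "\<not> (\<lambda>k::int. cmod (fourier_coeff (\<lambda>t. complex_of_real ((f \<circ> h) t)) k))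
               \<in> o[filtercomap abs at_top](\<lambda>k. 1 / \<bar>real_of_int k\<bar>)" (is "\<not> ?c \<in> _")
  proof
    have coeff: "cmod (scaled_coeff H m F) = 2 * pi * (real m * ?c (int m))" for m
    proof -
      let ?I = "\<lambda>t. of_real (F (H t)) * cis (- (real m * t))"
      have "continuous_on {0..2*pi} (\<lambda>t. F (H t))"
        by (rule continuous_on_compose2[OF hoelder_ball_continuous[OF F, of UNIV]])
           (use H(1) continuous_on_subset in auto)
      then have "continuous_on {0..2*pi} ?I" by (intro continuous_intros continuous_on_cis_mult)
      then have "(LBINT t:{0..2*pi}. ?I t) = integral {0..2*pi} ?I"
        by (intro set_borel_integral_eq_integral(2) borel_integrable_atLeastAtMost')
      moreover have "complex_of_real ((f \<circ> h) (abs_circle t)) * exp (- \<i> * of_int (int m) * of_real t) = ?I t" for t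
      proof -
        have "\<sigma> * (\<sigma> * H t) = H t" using \<sigma> by auto
        then have "(f \<circ> h) (abs_circle t) = F (H t)"
          by (simp only: o_apply spec[OF lift] f_abs)
        then show ?thesis by (simp add: cis_conv_exp mult.assoc)
      qed
      ultimately have "fourier_coeff (\<lambda>t. complex_of_real ((f \<circ> h) t)) (int m)
          = 1 / (2 * pi) * integral {0..2*pi} ?I"
        unfolding fourier_coeff_def by simp
      then show ?thesis by (simp add: scaled_coeff_def norm_mult norm_divide)
    qed
    assume "?c \<in> o[filtercomap abs at_top](\<lambda>k. 1 / \<bar>real_of_int k\<bar>)"
    then have "\<forall>\<^sub>F k in filtercomap abs at_top. norm (?c k) \<le> 1 * norm (1 / \<bar>real_of_int k\<bar>)"
      by (rule landau_o.smallD) simp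
    then obtain K :: int where K: "\<And>k. \<bar>k\<bar> \<ge> K \<Longrightarrow> ?c k \<le> 1 / \<bar>real_of_int k\<bar>"
      unfolding eventually_filtercomap_at_top_linorder by auto
    have "cmod (scaled_coeff H m F) \<le> 2 * pi * max 1 K" for m
    proof (cases "int m \<ge> K")
      case True
      then have "?c (int m) \<le> 1 / real m" using K[of "int m"] by simp
      then have "real m * ?c (int m) \<le> real m * (1 / real m)" by (intro mult_left_mono) auto
      also have "\<dots> \<le> 1" by simp
      also have "1 \<le> real_of_int (max 1 K)" by simp
      finally have "2 * pi * (real m * ?c (int m)) \<le> 2 * pi * max 1 K" by (intro mult_left_mono) auto
      then show ?thesis by (simp only: coeff)
    next
      case False
      have "cmod (scaled_coeff H m F) \<le> 2 * pi * real m" by (rule norm_scaled_coeff_le[OF H(1) F])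
      also have "\<dots> \<le> 2 * pi * max 1 K"
      proof (intro mult_left_mono)
        have "int m \<le> max 1 K" using False by simp
        then have "real_of_int (int m) \<le> real_of_int (max 1 K)" by (simp only: of_int_le_iff)
        then show "real m \<le> real_of_int (max 1 K)" by simp
      qed simp
      finally show ?thesis .
    qed
    moreover obtain m where "2 * pi * max 1 K < cmod (scaled_coeff H m F)"
      using F_unbounded by blast
    ultimately show False by (meson not_less)
  qed
  ultimately show "\<exists>f\<in>H_class sqrt. \<not> (\<lambda>k::int. cmod (fourier_coeff (\<lambda>t. complex_of_real ((f \<circ> h) t)) k))
               \<in> o[filtercomap abs at_top](\<lambda>k. 1 / \<bar>real_of_int k\<bar>)"
    by blast
qed

end
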